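(* For every $\varepsilon>0$ there exists $C_\varepsilon$ such that the following holds: if $G$ is a torsion-free additive (abelian) group and $X$ is a $G$-random variable with $H(X)\ge C_\varepsilon$, then $\sigma[X]\ge\sqrt{2}-\varepsilon$.
   Context: $G$ torsion-free means $nx\ne0$ for all $x\ne0$ in $G$ and all integers $n>0$. A $G$-random variable is a random variable taking values in $G$ with only finitely many values of positive probability. Entropy: $H(X)=\sum_x \mathbb{P}(X=x)\log\frac1{\mathbb{P}(X=x)}$ (natural log). Doubling constant: $\sigma[X]=\exp(H(X_1+X_2)-H(X))$ where $X_1,X_2$ are independent copies of $X$. *)

theory Defs
  imports "HOL-Algebra.Group" "HOL-Probability.Probability"
begin

text \<open>
  Abelian groups are \<^locale>\<open>comm_group\<close>s with an explicit carrier, so the group operation, which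
  is additive on paper, is written multiplicatively: \<open>n x\<close> becomes the power of \<open>x\<close> with exponent \<open>n\<close>.
\<close>

definition torsion_free :: "('a, 'm) monoid_scheme \<Rightarrow> bool" where
  "torsion_free G \<longleftrightarrow>
     (\<forall>x \<in> carrier G. x \<noteq> \<one>\<^bsub>G\<^esub> \<longrightarrow> (\<forall>n::nat. n > 0 \<longrightarrow> x [^]\<^bsub>G\<^esub> n \<noteq> \<one>\<^bsub>G\<^esub>))"

text \<open>
  Entropy and doubling constant depend only on the law of a random variable, so a random variable
  is represented by its law, a probability mass function.
\<close>

definition group_random_variable :: "('a, 'm) monoid_scheme \<Rightarrow> 'a pmf \<Rightarrow> bool" where
  "group_random_variable G X \<longleftrightarrow> set_pmf X \<subseteq> carrier G \<and> finite (set_pmf X)"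

definition shannon_entropy :: "'a pmf \<Rightarrow> real" where
  "shannon_entropy X = (\<Sum>x \<in> set_pmf X. pmf X x * ln (1 / pmf X x))"

text \<open>\<^const>\<open>pair_pmf\<close> \<open>X X\<close> is the joint law of two independent copies of \<open>X\<close>.\<close>

definition indep_sum :: "('a, 'm) monoid_scheme \<Rightarrow> 'a pmf \<Rightarrow> 'a pmf" where
  "indep_sum G X = map_pmf (\<lambda>(x1, x2). x1 \<otimes>\<^bsub>G\<^esub> x2) (pair_pmf X X)"

definition doubling_constant :: "('a, 'm) monoid_scheme \<Rightarrow> 'a pmf \<Rightarrow> real" where
  "doubling_constant G X = exp (shannon_entropy (indep_sum G X) - shannon_entropy X)"

text \<open>
  \<open>entropy_threshold TYPE('a) \<epsilon> C\<close>: the constant \<open>C\<close> is admissible as \<open>C\<^sub>\<epsilon>\<close> for every torsion-free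
  abelian group whose elements are taken from the type \<open>'a\<close>. The type argument makes it possible to
  say, without quantifying over types, that one and the same \<open>C\<close> is admissible for all types: there
  is a \<open>C\<close> admissible for \<^typ>\<open>nat\<close>, and every such \<open>C\<close> is admissible for \<open>'a\<close>, with \<open>'a\<close>
  arbitrary. Existence alone, stated for a free \<open>'a\<close>, would let \<open>C\<close> depend on \<open>'a\<close>.
\<close>

definition entropy_threshold :: "'a itself \<Rightarrow> real \<Rightarrow> real \<Rightarrow> bool" where
  "entropy_threshold (_ :: 'a itself) \<epsilon> C \<longleftrightarrow>
     (\<forall>(G :: 'a monoid) (X :: 'a pmf).
        comm_group G \<longrightarrow> torsion_free G \<longrightarrow> group_random_variable G X \<longrightarrow>
        shannon_entropy X \<ge> C \<longrightarrow> doubling_constant G X \<ge> sqrt 2 - \<epsilon>)"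

end

theory Submission
  imports Defs "HOL-Library.Nat_Bijection" "HOL-Algebra.Elementary_Groups" "HOL-Algebra.Weak_Morphisms"
begin

text \<open>
  A finitely supported random variable in a torsion-free abelian group has a Freiman-isomorphic copy
  in the integers, so everything happens there. Consider the Ruzsa distance
  \<open>d[X;Y] = H(X - Y) - H(X)/2 - H(Y)/2\<close> and let \<open>c\<close> be its limiting infimum as both entropies tend
  to infinity; the doubling constant of \<open>X\<close> is \<open>exp d[X;-X]\<close>. The fibring inequality
  \<open>d[X\<^sub>1 - X\<^sub>2; Y\<^sub>1 - Y\<^sub>2] + d[X\<^sub>1 | X\<^sub>1 - X\<^sub>2; Y\<^sub>1 | Y\<^sub>1 - Y\<^sub>2] \<le> 2 d[X;Y]\<close> turns near-minimisers
  into symmetric near-minimisers, as its conditional term is at least \<open>c - o(1)\<close>. By the same token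
  the residues of near-minimisers modulo \<open>2\<^sup>k\<close> have distance \<open>o(1)\<close> as long as their entropy stays
  bounded, which forces them to be either almost constant or of entropy at least \<open>ln 2 - o(1)\<close>. At the
  first \<open>k\<close> of the second kind, \<open>X + Y\<close> and \<open>X - Y\<close> nearly determine each other's residue modulo
  \<open>2\<^sup>k\<close>, while together they determine \<open>(X, Y)\<close>. So \<open>H(X + Y) + H(X - Y) \<ge> H(X) + H(Y) + ln 2 - o(1)\<close>,
  and by symmetry both terms on the left agree: \<open>2 c \<ge> ln 2\<close>.
\<close>

section \<open>Homomorphisms from torsion-free groups to the integers\<close>

text \<open>One homomorphism to the integers cannot be injective in general (two independent
  generators already prevent it), so only finitely many elements at a time are kept away from zero.
  Additivity is asked on a subgroup \<open>H\<close> alone, because a group such as the rationals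
  has no nonzero homomorphism to the integers.\<close>

definition int_separated :: "('a, 'm) monoid_scheme \<Rightarrow> 'a set \<Rightarrow> bool" where
  "int_separated G H \<longleftrightarrow> subgroup H G \<and>
    (\<forall>F. finite F \<longrightarrow> F \<subseteq> H - {\<one>\<^bsub>G\<^esub>} \<longrightarrow>
      (\<exists>\<phi> :: 'a \<Rightarrow> int. (\<forall>x\<in>H. \<forall>y\<in>H. \<phi> (x \<otimes>\<^bsub>G\<^esub> y) = \<phi> x + \<phi> y) \<and> (\<forall>x\<in>F. \<phi> x \<noteq> 0)))"

lemma int_separatedE:
  assumes "int_separated G H" "finite F" "F \<subseteq> H - {\<one>\<^bsub>G\<^esub>}"
  obtains \<phi> :: "'a \<Rightarrow> int" where "\<And>x y. x \<in> H \<Longrightarrow> y \<in> H \<Longrightarrow> \<phi> (x \<otimes>\<^bsub>G\<^esub> y) = \<phi> x + \<phi> y"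
    and "\<And>x. x \<in> F \<Longrightarrow> \<phi> x \<noteq> 0"
proof -
  have "\<exists>\<phi> :: 'a \<Rightarrow> int. (\<forall>x\<in>H. \<forall>y\<in>H. \<phi> (x \<otimes>\<^bsub>G\<^esub> y) = \<phi> x + \<phi> y) \<and> (\<forall>x\<in>F. \<phi> x \<noteq> 0)"
    using assms by (simp add: int_separated_def)
  thus ?thesis using that by blast
qed

text \<open>
  If \<open>s [^] m \<in> H\<close>, pull \<open>\<phi>\<close> back along \<open>x \<mapsto> x [^] m\<close>, which is injective as \<open>G\<close> is torsion-free.
  Otherwise \<open>H\<close> and \<open>s\<close> generate a direct product, and \<open>M * \<phi>\<close> plus the exponent of \<open>s\<close> works for
  large \<open>M\<close>.
\<close>

lemma int_separated_adjoin:
  fixes G (structure)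
  assumes G: "comm_group G"
    and tf: "torsion_free G" and sep: "int_separated G H" and s: "s \<in> carrier G"
  shows "\<exists>H'. H \<subseteq> H' \<and> s \<in> H' \<and> int_separated G H'"
proof -
  interpret comm_group G by (rule G)
  have H: "subgroup H G" using sep by (simp add: int_separated_def)
  note Hc = subgroup.mem_carrier[OF H]
  define H' where "H' = {h \<otimes> s [^] (j::int) | h j. h \<in> H}"
  have mult: "(h \<otimes> s [^] i) \<otimes> (h' \<otimes> s [^] j) = (h \<otimes> h') \<otimes> s [^] (i + j)"
    if "h \<in> carrier G" "h' \<in> carrier G" for h h' and i j :: int
    using that s by (simp add: int_pow_mult m_ac)
  have sub: "subgroup H' G"
  proof (rule subgroupI)
    show "H' \<subseteq> carrier G" using s Hc by (auto simp: H'_def)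
    show "H' \<noteq> {}" using subgroup.one_closed[OF H] by (auto simp: H'_def)
    fix a assume "a \<in> H'"
    then obtain h j where a: "a = h \<otimes> s [^] (j::int)" "h \<in> H" by (auto simp: H'_def)
    have "inv a = inv h \<otimes> s [^] (- j)"
      using a Hc s by (simp add: inv_mult int_pow_neg)
    thus "inv a \<in> H'" using subgroup.m_inv_closed[OF H a(2)] by (auto simp: H'_def)
    fix b assume "b \<in> H'"
    then obtain h' j' where b: "b = h' \<otimes> s [^] (j'::int)" "h' \<in> H" by (auto simp: H'_def)
    have "a \<otimes> b = (h \<otimes> h') \<otimes> s [^] (j + j')" using a b Hc by (simp add: mult)
    thus "a \<otimes> b \<in> H'" using subgroup.m_closed[OF H a(2) b(2)] by (auto simp: H'_def)
  qed
  have HH': "H \<subseteq> H'"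
  proof
    fix h assume "h \<in> H"
    moreover from this have "h = h \<otimes> s [^] (0::int)" using Hc by simp
    ultimately show "h \<in> H'" unfolding H'_def by blast
  qed
  have "s = \<one> \<otimes> s [^] (1::int)" using s by (simp add: int_pow_1)
  hence sH': "s \<in> H'" using subgroup.one_closed[OF H] unfolding H'_def by blast
  have "\<exists>\<phi> :: 'a \<Rightarrow> int. (\<forall>x\<in>H'. \<forall>y\<in>H'. \<phi> (x \<otimes> y) = \<phi> x + \<phi> y) \<and> (\<forall>x\<in>F. \<phi> x \<noteq> 0)"
    if F: "finite F" "F \<subseteq> H' - {\<one>}" for F
  proof (cases "\<exists>m::nat. m > 0 \<and> s [^] m \<in> H")
    case True
    then obtain m :: nat where m: "m > 0" "s [^] m \<in> H" by auto
    have pow: "x [^] m \<in> H" if x: "x \<in> H'" for x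
    proof -
      obtain h j where hj: "x = h \<otimes> s [^] (j::int)" "h \<in> H" using x by (auto simp: H'_def)
      have "(s [^] j) [^] m = (s [^] m) [^] j"
        using s by (simp add: int_pow_pow mult.commute flip: int_pow_int)
      hence "x [^] m = h [^] m \<otimes> (s [^] m) [^] j"
        using hj Hc s by (simp add: nat_pow_distrib)
      thus ?thesis
        using hj m(2) subgroup_int_pow_closed[OF H, of h "int m"]
        by (simp add: subgroup.m_closed[OF H] subgroup_int_pow_closed[OF H] int_pow_int)
    qed
    have "(\<lambda>x. x [^] m) ` F \<subseteq> H - {\<one>}"
      using F(2) pow tf m(1) subgroup.mem_carrier[OF sub] by (auto simp: torsion_free_def)
    then obtain \<phi> :: "'a \<Rightarrow> int" where \<phi>: "\<And>x y. x \<in> H \<Longrightarrow> y \<in> H \<Longrightarrow> \<phi> (x \<otimes> y) = \<phi> x + \<phi> y"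
      "\<And>x. x \<in> (\<lambda>x. x [^] m) ` F \<Longrightarrow> \<phi> x \<noteq> 0"
      by (rule int_separatedE[OF sep finite_imageI[OF F(1)]]) (rule that)
    show ?thesis
      using \<phi> pow subgroup.mem_carrier[OF sub]
      by (intro exI[of _ "\<lambda>x. \<phi> (x [^] m)"]) (auto simp: nat_pow_distrib)
  next
    case False
    \<comment> \<open>No nonzero power of \<open>s\<close> lies in \<open>H\<close>, so the
      decomposition of an element of \<open>H'\<close> is unique and \<open>hp\<close>,
      \<open>jp\<close> below are its two projections.\<close>
    have zero: "j = 0" if j: "s [^] (j::int) \<in> H" for j
    proof (rule ccontr)
      assume "j \<noteq> 0"
      hence "nat \<bar>j\<bar> > 0" by simp
      moreover have "s [^] nat \<bar>j\<bar> \<in> H"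
      proof (cases "j \<ge> 0")
        case True
        thus ?thesis using j by (simp add: pow_nat)
      next
        case False
        hence "s [^] nat \<bar>j\<bar> = inv (s [^] j)" using s by (simp add: int_pow_neg pow_nat flip: int_pow_int)
        thus ?thesis using subgroup.m_inv_closed[OF H j] by simp
      qed
      ultimately show False using False by blast
    qed
    have unique: "h = h' \<and> j = j'" if "h \<in> H" "h' \<in> H" "h \<otimes> s [^] (j::int) = h' \<otimes> s [^] j'" for h h' j j'
    proof -
      have c: "h \<in> carrier G" "h' \<in> carrier G" using that Hc by auto
      have "s [^] (j - j') = inv h \<otimes> (h \<otimes> s [^] j) \<otimes> inv (s [^] j')"
        using c s by (simp add: int_pow_diff m_assoc[symmetric])
      also have "\<dots> = inv h \<otimes> (h' \<otimes> s [^] j') \<otimes> inv (s [^] j')"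
        by (simp only: that(3))
      also have "\<dots> = inv h \<otimes> h'"
        using c s by (simp add: m_assoc)
      finally have "s [^] (j - j') \<in> H"
        using that H by (simp add: subgroup.m_closed subgroup.m_inv_closed)
      hence "j = j'" using zero by fastforce
      thus ?thesis using that(3) c s by auto
    qed
    define hp where "hp = (\<lambda>x. SOME h. h \<in> H \<and> (\<exists>j::int. x = h \<otimes> s [^] j))"
    define jp where "jp = (\<lambda>x. SOME j::int. \<exists>h\<in>H. x = h \<otimes> s [^] j)"
    have hp: "hp (h \<otimes> s [^] j) = h" if "h \<in> H" for h and j :: int
      unfolding hp_def by (rule some_equality) (use that unique in blast)+
    have jp: "jp (h \<otimes> s [^] j) = j" if "h \<in> H" for h and j :: int
      unfolding jp_def by (rule some_equality) (use that unique in blast)+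
    have "hp ` F - {\<one>} \<subseteq> H - {\<one>}" using F(2) hp by (auto simp: H'_def)
    then obtain \<phi> :: "'a \<Rightarrow> int" where \<phi>: "\<And>x y. x \<in> H \<Longrightarrow> y \<in> H \<Longrightarrow> \<phi> (x \<otimes> y) = \<phi> x + \<phi> y"
      "\<And>x. x \<in> hp ` F - {\<one>} \<Longrightarrow> \<phi> x \<noteq> 0"
      by (rule int_separatedE[OF sep finite_Diff[OF finite_imageI[OF F(1)]]]) (rule that)
    have "\<phi> (\<one> \<otimes> \<one>) = \<phi> \<one> + \<phi> \<one>" by (intro \<phi> subgroup.one_closed[OF H])
    hence \<phi>1: "\<phi> \<one> = 0" by simp
    \<comment> \<open>\<open>M\<close> exceeds every exponent occurring in \<open>F\<close>, so
      \<open>M * \<phi> h + j = 0\<close> forces \<open>\<phi> h = 0\<close> and then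
      \<open>j = 0\<close>.\<close>
    define M where "M = 1 + (\<Sum>x\<in>F. \<bar>jp x\<bar>)"
    have M: "\<bar>jp x\<bar> < M" if "x \<in> F" for x
    proof -
      have "\<bar>jp x\<bar> \<le> (\<Sum>x\<in>F. \<bar>jp x\<bar>)" using F(1) that by (intro member_le_sum) auto
      thus ?thesis by (simp add: M_def)
    qed
    define \<psi> where "\<psi> = (\<lambda>x. M * \<phi> (hp x) + jp x)"
    have "\<psi> (x \<otimes> y) = \<psi> x + \<psi> y" if xy: "x \<in> H'" "y \<in> H'" for x y
    proof -
      obtain h i where x: "x = h \<otimes> s [^] (i::int)" "h \<in> H" using xy(1) by (auto simp: H'_def)
      obtain h' j where y: "y = h' \<otimes> s [^] (j::int)" "h' \<in> H" using xy(2) by (auto simp: H'_def)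
      have "x \<otimes> y = (h \<otimes> h') \<otimes> s [^] (i + j)" using x y Hc by (simp add: mult)
      thus ?thesis
        using x y \<phi>(1) subgroup.m_closed[OF H] by (simp add: \<psi>_def hp jp algebra_simps)
    qed
    moreover have "\<psi> x \<noteq> 0" if x: "x \<in> F" for x
    proof
      assume 0: "\<psi> x = 0"
      have "x \<in> H'" using F(2) x by auto
      then obtain h j where hj: "x = h \<otimes> s [^] (j::int)" "h \<in> H" by (auto simp: H'_def)
      have eq: "M * \<phi> h + j = 0" "\<bar>j\<bar> < M" using 0 M[OF x] hj by (auto simp: \<psi>_def hp jp)
      have \<phi>h: "\<phi> h = 0"
      proof (rule ccontr)
        assume "\<phi> h \<noteq> 0"
        hence "M * 1 \<le> \<bar>M\<bar> * \<bar>\<phi> h\<bar>" using eq(2) by (intro mult_mono) auto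
        also have "\<dots> = \<bar>j\<bar>" using eq(1) by (simp flip: abs_mult)
        finally show False using eq(2) by simp
      qed
      have "hp x = h" using hp[OF hj(2)] hj(1) by simp
      hence "h = \<one>" using \<phi>(2)[of h] \<phi>h x by force
      moreover have "j = 0" using eq(1) \<phi>h by simp
      ultimately have "x = \<one>" using hj(1) by simp
      thus False using F(2) x by auto
    qed
    ultimately show ?thesis by blast
  qed
  hence "int_separated G H'" using sub by (simp add: int_separated_def)
  thus ?thesis using HH' sH' by blast
qed

text \<open>The elements of \<open>S\<close> are adjoined one at a time to the trivial subgroup,
  where there is nothing to separate.\<close>

lemma int_separated_exists:
  fixes G (structure)
  assumes "comm_group G" "torsion_free G" "finite S" "S \<subseteq> carrier G"
  shows "\<exists>H. S \<subseteq> H \<and> int_separated G H"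
  using assms(3,4)
proof (induction S rule: finite_induct)
  case empty
  have "\<exists>\<phi> :: 'a \<Rightarrow> int. (\<forall>x\<in>{\<one>}. \<forall>y\<in>{\<one>}. \<phi> (x \<otimes> y) = \<phi> x + \<phi> y) \<and> (\<forall>x\<in>F. \<phi> x \<noteq> 0)"
    if "F \<subseteq> {\<one>} - {\<one>}" for F
    using that by (intro exI[of _ "\<lambda>_. 0"]) auto
  hence "int_separated G {\<one>}" using group.triv_subgroup[OF comm_group.axioms(2)[OF assms(1)]] by (simp add: int_separated_def)
  thus ?case by auto
next
  case (insert s S)
  then obtain H where H: "S \<subseteq> H" "int_separated G H" by auto
  obtain H' where "H \<subseteq> H'" "s \<in> H'" "int_separated G H'"
    using int_separated_adjoin[OF assms(1,2) H(2), of s] insert.prems by auto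
  thus ?case using H(1) by blast
qed

text \<open>The integers carried over to the type \<open>nat\<close>, the type at which admissible
  constants are anchored.\<close>

definition nat_group :: "nat monoid" where
  "nat_group = image_group int_encode integer_group"

lemma iso_nat_group: "int_encode \<in> iso integer_group nat_group"
  unfolding nat_group_def by (rule inj_imp_image_group_iso[OF inj_int_encode])

lemma comm_group_nat_group: "comm_group nat_group"
proof -
  have "group nat_group"
    unfolding nat_group_def by (rule group.inj_imp_image_group_is_group[OF group_integer_group inj_int_encode])
  thus ?thesis
    by (intro comm_group.iso_imp_comm_group[OF abelian_integer_group] is_isoI[OF iso_nat_group] group.is_monoid)
qed

lemma mult_nat_group: "int_encode a \<otimes>\<^bsub>nat_group\<^esub> int_encode b = int_encode (a + b)"
  using hom_mult[OF Group.iso_imp_homomorphism[OF iso_nat_group], of a b] by simp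

lemma carrier_nat_group: "carrier nat_group = UNIV"
  by (simp add: nat_group_def image_group_carrier surj_int_encode)

lemma pow_nat_group: "int_encode z [^]\<^bsub>nat_group\<^esub> (n::nat) = int_encode (int n * z)"
  using hom_nat_pow[OF Group.iso_imp_homomorphism[OF iso_nat_group] _ group_integer_group
      comm_group.axioms(2)[OF comm_group_nat_group], of z n] by simp

lemma one_nat_group: "\<one>\<^bsub>nat_group\<^esub> = int_encode 0"
  by (simp add: nat_group_def image_group_one)

lemma torsion_free_nat_group: "torsion_free nat_group"
  unfolding torsion_free_def
  by (metis int_decode_inverse pow_nat_group one_nat_group int_encode_eq mult_eq_0_iff of_nat_eq_0_iff less_irrefl)

section \<open>Entropy of finitely supported random variables\<close>

text \<open>\<open>p\<close> serves as sample space and \<open>f\<close> as a random variable on it.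
  Joint entropies are those of tuples, and conditional entropies appear as differences
  \<open>ent p (\<lambda>w. (f w, g w)) - ent p g\<close>.\<close>

definition ent :: "'w pmf \<Rightarrow> ('w \<Rightarrow> 'b) \<Rightarrow> real" where
  "ent p f = shannon_entropy (map_pmf f p)"

lemma pmf_map_eq_sum:
  assumes "finite (set_pmf p)"
  shows "pmf (map_pmf f p) t = (\<Sum>w | w \<in> set_pmf p \<and> f w = t. pmf p w)"
proof -
  have "pmf (map_pmf f p) t = measure p (f -` {t} \<inter> set_pmf p)"
    by (simp add: pmf_map measure_Int_set_pmf)
  also have "f -` {t} \<inter> set_pmf p = {w. w \<in> set_pmf p \<and> f w = t}"
    by auto
  also have "measure p \<dots> = (\<Sum>w | w \<in> set_pmf p \<and> f w = t. pmf p w)"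
    using assms by (intro measure_measure_pmf_finite) auto
  finally show ?thesis .
qed

lemma sum_map_pmf:
  fixes \<phi> :: "'b \<Rightarrow> real"
  assumes "finite (set_pmf p)"
  shows "(\<Sum>t\<in>set_pmf (map_pmf f p). pmf (map_pmf f p) t * \<phi> t) = (\<Sum>w\<in>set_pmf p. pmf p w * \<phi> (f w))"
proof -
  have "(\<Sum>w\<in>set_pmf p. pmf p w * \<phi> (f w))
      = (\<Sum>t\<in>f ` set_pmf p. \<Sum>w | w \<in> set_pmf p \<and> f w = t. pmf p w * \<phi> (f w))"
    by (rule sum.image_gen[OF assms])
  also have "\<dots> = (\<Sum>t\<in>f ` set_pmf p. pmf (map_pmf f p) t * \<phi> t)"
    by (intro sum.cong refl) (simp add: pmf_map_eq_sum[OF assms] sum_distrib_right)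
  finally show ?thesis by simp
qed

lemma pmf_map_pos: "w \<in> set_pmf p \<Longrightarrow> pmf (map_pmf f p) (f w) > 0"
  by (intro pmf_positive) auto

lemma ent_expectation:
  assumes "finite (set_pmf p)"
  shows "ent p f = (\<Sum>w\<in>set_pmf p. pmf p w * ln (1 / pmf (map_pmf f p) (f w)))"
  unfolding ent_def shannon_entropy_def by (rule sum_map_pmf[OF assms])

lemma ent_ident: "ent p (\<lambda>x. x) = shannon_entropy p"
  by (simp add: ent_def)

lemma ent_map: "ent (map_pmf g p) f = ent p (\<lambda>w. f (g w))"
  by (simp add: ent_def map_pmf_comp)

lemma ent_cong: "(\<And>w. w \<in> set_pmf p \<Longrightarrow> f w = g w) \<Longrightarrow> ent p f = ent p g"
  unfolding ent_def by (metis map_pmf_cong)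

lemma ent_nonneg: "ent p f \<ge> 0"
proof -
  have "pmf q x * ln (1 / pmf q x) \<ge> 0" if "x \<in> set_pmf q" for q :: "'b pmf" and x
    using that pmf_positive[OF that] pmf_le_1[of q x] by (intro mult_nonneg_nonneg) auto
  thus ?thesis unfolding ent_def shannon_entropy_def by (intro sum_nonneg) auto
qed

lemma ent_const: "ent p (\<lambda>_. c) = 0"
  by (simp add: ent_def shannon_entropy_def)

text \<open>On the support, each level set of \<open>f\<close> lies inside one of \<open>g\<close>,
  so the comparison holds pointwise for the logarithms being averaged.\<close>

lemma ent_mono:
  assumes fin: "finite (set_pmf p)"
    and det: "\<And>w w'. w \<in> set_pmf p \<Longrightarrow> w' \<in> set_pmf p \<Longrightarrow> f w = f w' \<Longrightarrow> g w = g w'"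
  shows "ent p g \<le> ent p f"
  unfolding ent_expectation[OF fin]
proof (intro sum_mono mult_left_mono)
  fix w assume w: "w \<in> set_pmf p"
  have "pmf (map_pmf f p) (f w) \<le> pmf (map_pmf g p) (g w)"
    unfolding pmf_map_eq_sum[OF fin] using fin by (intro sum_mono2) (auto intro: det w)
  thus "ln (1 / pmf (map_pmf g p) (g w)) \<le> ln (1 / pmf (map_pmf f p) (f w))"
    using pmf_map_pos[OF w, of f] pmf_map_pos[OF w, of g] by (simp add: ln_div)
qed auto

lemma ent_eq:
  assumes "finite (set_pmf p)"
    and "\<And>w w'. w \<in> set_pmf p \<Longrightarrow> w' \<in> set_pmf p \<Longrightarrow> f w = f w' \<longleftrightarrow> g w = g w'"
  shows "ent p f = ent p g"
  by (intro antisym ent_mono assms(1); simp add: assms(2))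

lemma sum_pmf_map_fst:
  assumes "finite (set_pmf p)"
  shows "(\<Sum>a\<in>f ` set_pmf p. pmf (map_pmf (\<lambda>w. (f w, h w)) p) (a, c)) = pmf (map_pmf h p) c"
proof -
  have "pmf (map_pmf h p) c = (\<Sum>w | w \<in> set_pmf p \<and> h w = c. pmf p w)"
    by (rule pmf_map_eq_sum[OF assms])
  also have "\<dots> = (\<Sum>a\<in>f ` set_pmf p. \<Sum>w | w \<in> {w. w \<in> set_pmf p \<and> h w = c} \<and> f w = a. pmf p w)"
    using assms by (intro sum.group[symmetric]) auto
  also have "\<dots> = (\<Sum>a\<in>f ` set_pmf p. pmf (map_pmf (\<lambda>w. (f w, h w)) p) (a, c))"
    unfolding pmf_map_eq_sum[OF assms] by (intro sum.cong refl) auto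
  finally show ?thesis ..
qed

text \<open>Gibbs' inequality for the conditionally independent coupling of \<open>f\<close> and \<open>g\<close> over \<open>h\<close>.\<close>

lemma ent_submodular:
  assumes fin: "finite (set_pmf p)"
  shows "ent p (\<lambda>w. (f w, g w, h w)) + ent p h \<le> ent p (\<lambda>w. (f w, h w)) + ent p (\<lambda>w. (g w, h w))"
proof -
  let ?S = "set_pmf p"
  define F where "F = pmf (map_pmf (\<lambda>w. (f w, h w)) p)"
  define K where "K = pmf (map_pmf (\<lambda>w. (g w, h w)) p)"
  define J where "J = pmf (map_pmf (\<lambda>w. (f w, g w, h w)) p)"
  define N where "N = pmf (map_pmf h p)"
  have pos: "F (f w, h w) > 0" "K (g w, h w) > 0" "J (f w, g w, h w) > 0" "N (h w) > 0" if "w \<in> ?S" for w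
    using pmf_map_pos[OF that, of "\<lambda>w. (f w, h w)"] pmf_map_pos[OF that, of "\<lambda>w. (g w, h w)"]
      pmf_map_pos[OF that, of "\<lambda>w. (f w, g w, h w)"] pmf_map_pos[OF that, of h]
    by (auto simp: F_def K_def J_def N_def)
  \<comment> \<open>\<open>R\<close> is the ratio of the conditionally independent coupling to the
    joint law; \<open>ln R \<le> R - 1\<close> reduces the claim to a bound on the mass of that
    coupling.\<close>
  define R where "R = (\<lambda>(a, b, c). F (a, c) * K (b, c) / (J (a, b, c) * N c))"
  have "ent p (\<lambda>w. (f w, g w, h w)) + ent p h - ent p (\<lambda>w. (f w, h w)) - ent p (\<lambda>w. (g w, h w))
      = (\<Sum>w\<in>?S. pmf p w * (ln (1 / J (f w, g w, h w)) + ln (1 / N (h w)) - ln (1 / F (f w, h w)) - ln (1 / K (g w, h w))))"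
    unfolding ent_expectation[OF fin] F_def K_def J_def N_def
    by (simp add: sum.distrib sum_subtractf algebra_simps)
  also have "\<dots> = (\<Sum>w\<in>?S. pmf p w * ln (R (f w, g w, h w)))"
  proof (intro sum.cong refl)
    fix w assume "w \<in> ?S"
    from pos[OF this] show "pmf p w * (ln (1 / J (f w, g w, h w)) + ln (1 / N (h w)) - ln (1 / F (f w, h w)) - ln (1 / K (g w, h w)))
      = pmf p w * ln (R (f w, g w, h w))"
      by (simp add: R_def ln_div ln_mult)
  qed
  also have "\<dots> \<le> (\<Sum>w\<in>?S. pmf p w * (R (f w, g w, h w) - 1))"
    by (intro sum_mono mult_left_mono ln_le_minus_one) (auto simp: R_def pos)
  also have "\<dots> = (\<Sum>w\<in>?S. pmf p w * R (f w, g w, h w)) - 1"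
    using sum_pmf_eq_1[OF fin order_refl] by (simp add: algebra_simps sum_subtractf)
  also have "(\<Sum>w\<in>?S. pmf p w * R (f w, g w, h w)) = (\<Sum>t\<in>(\<lambda>w. (f w, g w, h w)) ` ?S. J t * R t)"
    using sum_map_pmf[OF fin, of "\<lambda>w. (f w, g w, h w)" R] by (simp add: J_def)
  also have "\<dots> = (\<Sum>(a, b, c)\<in>(\<lambda>w. (f w, g w, h w)) ` ?S. F (a, c) * K (b, c) / N c)"
    by (intro sum.cong refl) (use pos in \<open>force simp: R_def\<close>)
  \<comment> \<open>The coupling may also charge triples outside the joint support, hence only an
    inequality.\<close>
  also have "\<dots> \<le> (\<Sum>(a, b, c)\<in>f ` ?S \<times> g ` ?S \<times> h ` ?S. F (a, c) * K (b, c) / N c)"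
    using fin by (intro sum_mono2) (auto simp: F_def K_def N_def)
  also have "\<dots> = (\<Sum>a\<in>f ` ?S. \<Sum>b\<in>g ` ?S. \<Sum>c\<in>h ` ?S. F (a, c) * K (b, c) / N c)"
    by (simp add: sum.cartesian_product)
  also have "\<dots> = (\<Sum>a\<in>f ` ?S. \<Sum>c\<in>h ` ?S. \<Sum>b\<in>g ` ?S. F (a, c) * K (b, c) / N c)"
    by (intro sum.cong refl sum.swap)
  also have "\<dots> = (\<Sum>c\<in>h ` ?S. \<Sum>a\<in>f ` ?S. \<Sum>b\<in>g ` ?S. F (a, c) * K (b, c) / N c)"
    by (rule sum.swap)
  also have "\<dots> = (\<Sum>c\<in>h ` ?S. (\<Sum>a\<in>f ` ?S. F (a, c)) * (\<Sum>b\<in>g ` ?S. K (b, c)) / N c)"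
    by (simp add: sum_product sum_divide_distrib)
  also have "\<dots> = (\<Sum>c\<in>h ` ?S. N c)"
    using sum_pmf_map_fst[OF fin, of f h] sum_pmf_map_fst[OF fin, of g h] pos(4)
    by (intro sum.cong refl) (auto simp: F_def K_def N_def)
  also have "\<dots> = 1"
    unfolding N_def using fin by (intro sum_pmf_eq_1) auto
  finally show ?thesis by simp
qed

lemma ent_subadditive:
  assumes "finite (set_pmf p)"
  shows "ent p (\<lambda>w. (f w, g w)) \<le> ent p f + ent p g"
proof -
  have "ent p (\<lambda>w. (f w, g w)) = ent p (\<lambda>w. (f w, g w, ()))"
    "ent p f = ent p (\<lambda>w. (f w, ()))" "ent p g = ent p (\<lambda>w. (g w, ()))"
    by (intro ent_eq[OF assms]; simp)+
  thus ?thesis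
    using ent_submodular[OF assms, of f g "\<lambda>_. ()"] by (simp add: ent_const)
qed

section \<open>Independent pairs\<close>

lemma ent_fst_pair [simp]: "ent (pair_pmf p q) (\<lambda>w. f (fst w)) = ent p f"
  using ent_map[of fst "pair_pmf p q" f] by (simp add: map_fst_pair_pmf)

lemma ent_snd_pair [simp]: "ent (pair_pmf p q) (\<lambda>w. f (snd w)) = ent q f"
  using ent_map[of snd "pair_pmf p q" f] by (simp add: map_snd_pair_pmf)

lemma ent_pair:
  assumes "finite (set_pmf p)" "finite (set_pmf q)"
  shows "ent (pair_pmf p q) (\<lambda>w. (f (fst w), g (snd w))) = ent p f + ent q g"
proof -
  let ?P = "pair_pmf p q"
  have fin: "finite (set_pmf ?P)" using assms by simp
  have map: "map_pmf (\<lambda>w. (f (fst w), g (snd w))) ?P = pair_pmf (map_pmf f p) (map_pmf g q)"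
    using map_pair[of f g p q] by (simp add: case_prod_beta')
  have "ent ?P (\<lambda>w. (f (fst w), g (snd w)))
      = (\<Sum>w\<in>set_pmf ?P. pmf ?P w * (ln (1 / pmf (map_pmf f p) (f (fst w))) + ln (1 / pmf (map_pmf g q) (g (snd w)))))"
    unfolding ent_expectation[OF fin] map
    by (intro sum.cong refl) (auto simp: pmf_pair pmf_map_pos[THEN less_imp_neq, symmetric] ln_div ln_mult)
  also have "\<dots> = ent ?P (\<lambda>w. f (fst w)) + ent ?P (\<lambda>w. g (snd w))"
    unfolding ent_expectation[OF fin]
    using map_pmf_comp[of f fst ?P] map_pmf_comp[of g snd ?P]
    by (simp add: map_fst_pair_pmf map_snd_pair_pmf sum.distrib algebra_simps)
  finally show ?thesis by simp
qed

section \<open>Conditioning and the chain rule\<close>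

abbreviation fibre :: "'w pmf \<Rightarrow> ('w \<Rightarrow> 'b) \<Rightarrow> 'b \<Rightarrow> 'w pmf" where
  "fibre p g i \<equiv> cond_pmf p (g -` {i})"

text \<open>Inside a fibre the law is renormalised by the weight of the fibre, so the logarithm
  splits into a joint and a marginal part. The sum runs over attained values only, since
  conditioning is meaningful on events of positive probability.\<close>

lemma ent_chain:
  assumes fin: "finite (set_pmf p)"
  shows "ent p (\<lambda>w. (f w, g w)) = ent p g + (\<Sum>i\<in>g ` set_pmf p. pmf (map_pmf g p) i * ent (fibre p g i) f)"
proof -
  let ?S = "set_pmf p"
  let ?N = "pmf (map_pmf g p)"
  have fib: "set_pmf (fibre p g i) = {w \<in> ?S. g w = i}"
    "\<And>w. w \<in> ?S \<Longrightarrow> g w = i \<Longrightarrow> pmf (fibre p g i) w = pmf p w / ?N i"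
    "\<And>w. w \<in> ?S \<Longrightarrow> g w = i \<Longrightarrow> pmf (map_pmf f (fibre p g i)) (f w) = pmf (map_pmf (\<lambda>w. (f w, g w)) p) (f w, i) / ?N i"
    if i: "i \<in> g ` ?S" for i
  proof -
    have ne: "?S \<inter> g -` {i} \<noteq> {}" using i by auto
    show set: "set_pmf (fibre p g i) = {w \<in> ?S. g w = i}"
      using set_cond_pmf[OF ne] by auto
    show pm: "pmf (fibre p g i) w = pmf p w / ?N i" if "g w = i" for w
      using that by (simp add: pmf_cond[OF ne] pmf_map)
    have "pmf (map_pmf f (fibre p g i)) t = pmf (map_pmf (\<lambda>w. (f w, g w)) p) (t, i) / ?N i" for t
    proof -
      have "pmf (map_pmf f (fibre p g i)) t = (\<Sum>w | w \<in> ?S \<and> g w = i \<and> f w = t. pmf p w / ?N i)"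
        using fin set pm by (subst pmf_map_eq_sum) (auto intro!: sum.cong)
      also have "\<dots> = pmf (map_pmf (\<lambda>w. (f w, g w)) p) (t, i) / ?N i"
        unfolding pmf_map_eq_sum[OF fin] sum_divide_distrib by (intro sum.cong) auto
      finally show ?thesis .
    qed
    thus "pmf (map_pmf f (fibre p g i)) (f w) = pmf (map_pmf (\<lambda>w. (f w, g w)) p) (f w, i) / ?N i" for w .
  qed
  have "?N i * ent (fibre p g i) f
      = (\<Sum>w | w \<in> ?S \<and> g w = i. pmf p w * (ln (1 / pmf (map_pmf (\<lambda>w. (f w, g w)) p) (f w, g w)) - ln (1 / ?N (g w))))"
    if i: "i \<in> g ` ?S" for i
  proof -
    have finf: "finite (set_pmf (fibre p g i))" using fin fib(1)[OF i] by simp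
    show ?thesis
      unfolding ent_expectation[OF finf] fib(1)[OF i] sum_distrib_left
    proof (intro sum.cong refl)
      fix w assume "w \<in> {w \<in> ?S. g w = i}"
      hence w: "w \<in> ?S" "g w = i" by auto
      show "?N i * (pmf (fibre p g i) w * ln (1 / pmf (map_pmf f (fibre p g i)) (f w)))
        = pmf p w * (ln (1 / pmf (map_pmf (\<lambda>w. (f w, g w)) p) (f w, g w)) - ln (1 / ?N (g w)))"
        using pmf_map_pos[OF w(1), of g] pmf_map_pos[OF w(1), of "\<lambda>w. (f w, g w)"] w
        by (simp add: fib(2,3)[OF i w] ln_div)
    qed
  qed
  hence "(\<Sum>i\<in>g ` ?S. ?N i * ent (fibre p g i) f)
    = (\<Sum>i\<in>g ` ?S. \<Sum>w | w \<in> ?S \<and> g w = i. pmf p w * (ln (1 / pmf (map_pmf (\<lambda>w. (f w, g w)) p) (f w, g w)) - ln (1 / ?N (g w))))"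
    by simp
  also have "\<dots> = (\<Sum>w\<in>?S. pmf p w * (ln (1 / pmf (map_pmf (\<lambda>w. (f w, g w)) p) (f w, g w)) - ln (1 / ?N (g w))))"
    by (rule sum.image_gen[OF fin, symmetric])
  also have "\<dots> = ent p (\<lambda>w. (f w, g w)) - ent p g"
    unfolding ent_expectation[OF fin] by (simp add: sum_subtractf algebra_simps)
  finally show ?thesis by simp
qed

lemma measure_pair_pmf_Times: "measure (pair_pmf p q) (A \<times> B) = measure p A * measure q B"
proof -
  have "measure (pair_pmf p q) (A \<times> B)
      = pmf (map_pmf (\<lambda>w. (fst w \<in> A, snd w \<in> B)) (pair_pmf p q)) (True, True)"
    unfolding pmf_map by (rule arg_cong[where f = "measure _"]) (simp add: set_eq_iff)
  also have "map_pmf (\<lambda>w. (fst w \<in> A, snd w \<in> B)) (pair_pmf p q)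
      = pair_pmf (map_pmf (\<lambda>x. x \<in> A) p) (map_pmf (\<lambda>y. y \<in> B) q)"
    using map_pair[of "\<lambda>x. x \<in> A" "\<lambda>y. y \<in> B" p q] by (simp add: case_prod_beta')
  also have "pmf \<dots> (True, True) = measure p A * measure q B"
    unfolding pmf_pair pmf_map by (simp add: vimage_def)
  finally show ?thesis .
qed

lemma cond_pair_pmf:
  assumes "set_pmf p \<inter> A \<noteq> {}" "set_pmf q \<inter> B \<noteq> {}"
  shows "cond_pmf (pair_pmf p q) (A \<times> B) = pair_pmf (cond_pmf p A) (cond_pmf q B)"
proof -
  have ne: "set_pmf (pair_pmf p q) \<inter> A \<times> B \<noteq> {}" using assms by auto
  show ?thesis
    by (intro pmf_eqI) (auto simp: measure_pair_pmf_Times pmf_cond[OF ne] pmf_cond[OF assms(1)] pmf_cond[OF assms(2)] pmf_pair split: if_splits)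
qed

lemma cond_pmf_UNIV: "cond_pmf p UNIV = p"
proof -
  have ne: "set_pmf p \<inter> UNIV \<noteq> {}" using set_pmf_not_empty[of p] by auto
  show ?thesis by (intro pmf_eqI) (simp add: pmf_cond[OF ne])
qed

text \<open>For each fixed \<open>y\<close>, the value of \<open>f\<close> determines that of
  \<open>g\<close>, so \<open>(f, y)\<close> determines \<open>(g, y)\<close>; by independence the
  entropy of \<open>y\<close> then cancels.\<close>

lemma ent_ge_fst:
  assumes fin: "finite (set_pmf p)" "finite (set_pmf q)"
    and det: "\<And>x x' y. x \<in> set_pmf p \<Longrightarrow> x' \<in> set_pmf p \<Longrightarrow> y \<in> set_pmf q \<Longrightarrow> f (x, y) = f (x', y) \<Longrightarrow> g x = g x'"
  shows "ent p g \<le> ent (pair_pmf p q) f"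
proof -
  have finP: "finite (set_pmf (pair_pmf p q))" using fin by simp
  have "ent p g + ent q (\<lambda>y. y) = ent (pair_pmf p q) (\<lambda>w. (g (fst w), snd w))"
    by (rule ent_pair[OF fin, symmetric])
  also have "\<dots> \<le> ent (pair_pmf p q) (\<lambda>w. (f w, snd w))"
    by (rule ent_mono[OF finP]) (auto intro: det)
  also have "\<dots> \<le> ent (pair_pmf p q) f + ent (pair_pmf p q) snd"
    by (rule ent_subadditive[OF finP])
  finally show ?thesis using ent_snd_pair[of p q "\<lambda>y. y"] by simp
qed

lemma ent_swap: "ent (pair_pmf q p) f = ent (pair_pmf p q) (\<lambda>w. f (snd w, fst w))"
  by (subst pair_commute_pmf) (simp add: ent_map case_prod_beta')

lemma ent_ge_snd:
  assumes fin: "finite (set_pmf p)" "finite (set_pmf q)"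
    and det: "\<And>x y y'. x \<in> set_pmf p \<Longrightarrow> y \<in> set_pmf q \<Longrightarrow> y' \<in> set_pmf q \<Longrightarrow> f (x, y) = f (x, y') \<Longrightarrow> g y = g y'"
  shows "ent q g \<le> ent (pair_pmf p q) f"
proof -
  have "ent q g \<le> ent (pair_pmf q p) (\<lambda>w. f (snd w, fst w))"
    by (rule ent_ge_fst[OF fin(2,1)]) (auto intro: det)
  thus ?thesis by (simp add: ent_swap[of q p])
qed

lemma ent_graph: "finite (set_pmf p) \<Longrightarrow> ent p (\<lambda>w. (f w, \<phi> (f w))) = ent p f"
  by (rule ent_eq) auto

lemma ent_diff_right:
  fixes f g :: "'w \<Rightarrow> 'a::ab_group_add"
  shows "finite (set_pmf p) \<Longrightarrow> ent p (\<lambda>w. (f w, f w - g w)) = ent p (\<lambda>w. (f w, g w))"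
  by (rule ent_eq) (auto dest: arg_cong[where f = "(-) (f _)"])

text \<open>In rearranged form: the mutual information with \<open>g\<close> can only drop when
  \<open>f\<close> is replaced by a function of \<open>f\<close>. This is submodularity over
  \<open>\<phi> (f w)\<close>.\<close>

lemma ent_data_processing:
  assumes fin: "finite (set_pmf p)"
  shows "ent p (\<lambda>w. (f w, g w)) + ent p (\<lambda>w. \<phi> (f w)) \<le> ent p (\<lambda>w. (\<phi> (f w), g w)) + ent p f"
proof -
  have "ent p (\<lambda>w. (f w, g w)) = ent p (\<lambda>w. (g w, f w, \<phi> (f w)))"
    "ent p (\<lambda>w. (\<phi> (f w), g w)) = ent p (\<lambda>w. (g w, \<phi> (f w)))"
    "ent p f = ent p (\<lambda>w. (f w, \<phi> (f w)))"
    by (intro ent_eq[OF fin]; auto)+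
  thus ?thesis using ent_submodular[OF fin, of g f "\<lambda>w. \<phi> (f w)"] by simp
qed

section \<open>Entropic Ruzsa distance\<close>

definition rdist :: "'a::ab_group_add pmf \<Rightarrow> 'a pmf \<Rightarrow> real" where
  "rdist X Y = ent (pair_pmf X Y) (\<lambda>w. fst w - snd w) - (shannon_entropy X + shannon_entropy Y) / 2"

text \<open>The conditional distance \<open>d[f | g; f' | g']\<close>, averaged over pairs of
  fibres. The two variables live on separate sample spaces, so the conditionings are
  independent.\<close>

definition crdist ::
    "'v pmf \<Rightarrow> ('v \<Rightarrow> 'a::ab_group_add) \<Rightarrow> ('v \<Rightarrow> 'i) \<Rightarrow> 'w pmf \<Rightarrow> ('w \<Rightarrow> 'a) \<Rightarrow> ('w \<Rightarrow> 'j) \<Rightarrow> real" where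
  "crdist p f g q f' g' =
     (\<Sum>i\<in>g ` set_pmf p. \<Sum>j\<in>g' ` set_pmf q. pmf (map_pmf g p) i * pmf (map_pmf g' q) j *
        rdist (map_pmf f (fibre p g i)) (map_pmf f' (fibre q g' j)))"

lemma rdist_ge:
  assumes "finite (set_pmf X)" "finite (set_pmf Y)"
  shows "\<bar>shannon_entropy X - shannon_entropy Y\<bar> / 2 \<le> rdist X Y"
proof -
  have "ent X (\<lambda>x. x) \<le> ent (pair_pmf X Y) (\<lambda>w. fst w - snd w)"
    "ent Y (\<lambda>x. x) \<le> ent (pair_pmf X Y) (\<lambda>w. fst w - snd w)"
    by (intro ent_ge_fst ent_ge_snd assms; simp)+
  thus ?thesis by (auto simp: rdist_def ent_ident abs_if field_simps)
qed

lemma rdist_commute: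
  assumes "finite (set_pmf X)" "finite (set_pmf Y)"
  shows "rdist Y X = rdist X Y"
proof -
  have "ent (pair_pmf X Y) (\<lambda>w. snd w - fst w) = ent (pair_pmf X Y) (\<lambda>w. fst w - snd w)"
    using assms by (intro ent_eq) (auto simp: algebra_simps)
  thus ?thesis by (simp add: rdist_def ent_swap[of Y X])
qed

text \<open>Writing the conditional distance with joint entropies opens it to submodularity. The
  chain rule is used on the product space and on both factors.\<close>

lemma crdist_altdef:
  assumes fin: "finite (set_pmf p)" "finite (set_pmf q)"
  shows "crdist p f g q f' g'
    = (ent (pair_pmf p q) (\<lambda>w. (f (fst w) - f' (snd w), g (fst w), g' (snd w))) - ent p g - ent q g')
      - (ent p (\<lambda>w. (f w, g w)) - ent p g + (ent q (\<lambda>w. (f' w, g' w)) - ent q g')) / 2"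
proof -
  define P where "P = pmf (map_pmf g p)"
  define Q where "Q = pmf (map_pmf g' q)"
  define a where "a = (\<lambda>i. ent (fibre p g i) f)"
  define b where "b = (\<lambda>j. ent (fibre q g' j) f')"
  let ?I = "g ` set_pmf p" and ?J = "g' ` set_pmf q"
  define e where "e = (\<lambda>i j. ent (pair_pmf (fibre p g i) (fibre q g' j)) (\<lambda>w. f (fst w) - f' (snd w)))"
  have finP: "finite (set_pmf (pair_pmf p q))" using fin by simp
  have sums: "sum P ?I = 1" "sum Q ?J = 1"
    unfolding P_def Q_def using fin by (auto intro!: sum_pmf_eq_1)
  have img: "(\<lambda>w. (g (fst w), g' (snd w))) ` set_pmf (pair_pmf p q) = ?I \<times> ?J"
    by force
  have rd: "rdist (map_pmf f (fibre p g i)) (map_pmf f' (fibre q g' j)) = e i j - (a i + b j) / 2" for i j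
  proof -
    have "pair_pmf (map_pmf f (fibre p g i)) (map_pmf f' (fibre q g' j))
        = map_pmf (\<lambda>w. (f (fst w), f' (snd w))) (pair_pmf (fibre p g i) (fibre q g' j))"
      using map_pair[of f f' "fibre p g i" "fibre q g' j"] by (simp add: case_prod_beta')
    thus ?thesis by (simp add: rdist_def e_def a_def b_def ent_map flip: ent_ident)
  qed
  have "ent (pair_pmf p q) (\<lambda>w. (f (fst w) - f' (snd w), g (fst w), g' (snd w)))
    = ent (pair_pmf p q) (\<lambda>w. (g (fst w), g' (snd w))) +
      (\<Sum>k\<in>?I \<times> ?J. pmf (map_pmf (\<lambda>w. (g (fst w), g' (snd w))) (pair_pmf p q)) k *
        ent (fibre (pair_pmf p q) (\<lambda>w. (g (fst w), g' (snd w))) k) (\<lambda>w. f (fst w) - f' (snd w)))"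
    using ent_chain[OF finP, of "\<lambda>w. f (fst w) - f' (snd w)" "\<lambda>w. (g (fst w), g' (snd w))"]
    unfolding img .
  also have "(\<Sum>k\<in>?I \<times> ?J. pmf (map_pmf (\<lambda>w. (g (fst w), g' (snd w))) (pair_pmf p q)) k *
        ent (fibre (pair_pmf p q) (\<lambda>w. (g (fst w), g' (snd w))) k) (\<lambda>w. f (fst w) - f' (snd w)))
    = (\<Sum>(i, j)\<in>?I \<times> ?J. P i * Q j * e i j)"
  proof (intro sum.cong refl, clarsimp simp del: image_eqI)
    fix x y assume x: "x \<in> set_pmf p" and y: "y \<in> set_pmf q"
    have "(\<lambda>w. (g (fst w), g' (snd w))) -` {(g x, g' y)} = (g -` {g x}) \<times> (g' -` {g' y})"
      by auto
    moreover have "cond_pmf (pair_pmf p q) ((g -` {g x}) \<times> (g' -` {g' y})) = pair_pmf (fibre p g (g x)) (fibre q g' (g' y))"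
      using x y by (intro cond_pair_pmf) auto
    moreover have "map_pmf (\<lambda>w. (g (fst w), g' (snd w))) (pair_pmf p q) = pair_pmf (map_pmf g p) (map_pmf g' q)"
      using map_pair[of g g' p q] by (simp add: case_prod_beta')
    ultimately show "pmf (map_pmf (\<lambda>w. (g (fst w), g' (snd w))) (pair_pmf p q)) (g x, g' y) *
        ent (fibre (pair_pmf p q) (\<lambda>w. (g (fst w), g' (snd w))) (g x, g' y)) (\<lambda>w. f (fst w) - f' (snd w))
        = P (g x) * Q (g' y) * e (g x) (g' y)"
      by (simp add: e_def P_def Q_def pmf_pair)
  qed
  also have "\<dots> = (\<Sum>i\<in>?I. \<Sum>j\<in>?J. P i * Q j * e i j)"
    by (simp add: sum.cartesian_product)
  finally have E: "ent (pair_pmf p q) (\<lambda>w. (f (fst w) - f' (snd w), g (fst w), g' (snd w)))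
     = ent p g + ent q g' + (\<Sum>i\<in>?I. \<Sum>j\<in>?J. P i * Q j * e i j)"
    by (simp add: ent_pair[OF fin])
  have A: "ent p (\<lambda>w. (f w, g w)) - ent p g = (\<Sum>i\<in>?I. \<Sum>j\<in>?J. P i * Q j * a i)"
  proof -
    have "(\<Sum>i\<in>?I. \<Sum>j\<in>?J. P i * Q j * a i) = (\<Sum>i\<in>?I. P i * a i * sum Q ?J)"
      by (simp add: sum_distrib_left algebra_simps)
    thus ?thesis using ent_chain[OF fin(1), of f g] sums by (simp add: P_def a_def)
  qed
  have B: "ent q (\<lambda>w. (f' w, g' w)) - ent q g' = (\<Sum>i\<in>?I. \<Sum>j\<in>?J. P i * Q j * b j)"
  proof -
    have "(\<Sum>i\<in>?I. \<Sum>j\<in>?J. P i * Q j * b j) = (\<Sum>i\<in>?I. P i * (\<Sum>j\<in>?J. Q j * b j))"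
      by (simp add: sum_distrib_left algebra_simps)
    also have "\<dots> = (\<Sum>j\<in>?J. Q j * b j)"
      using sums by (simp flip: sum_distrib_right)
    finally show ?thesis using ent_chain[OF fin(2), of f' g'] by (simp add: Q_def b_def)
  qed
  have "crdist p f g q f' g' = (\<Sum>i\<in>?I. \<Sum>j\<in>?J. P i * Q j * (e i j - (a i + b j) / 2))"
    by (simp add: crdist_def rd P_def Q_def)
  also have "\<dots> = (\<Sum>i\<in>?I. \<Sum>j\<in>?J. P i * Q j * e i j - P i * Q j * a i / 2 - P i * Q j * b j / 2)"
    by (intro sum.cong refl) (simp add: field_simps)
  also have "\<dots> = (\<Sum>i\<in>?I. \<Sum>j\<in>?J. P i * Q j * e i j)
      - ((\<Sum>i\<in>?I. \<Sum>j\<in>?J. P i * Q j * a i) + (\<Sum>i\<in>?I. \<Sum>j\<in>?J. P i * Q j * b j)) / 2"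
    by (simp add: sum_subtractf add_divide_distrib flip: sum_divide_distrib)
  finally show ?thesis using E A B by simp
qed

text \<open>
  If the two averages are large but \<open>a\<close> is small on a set of weight \<open>\<alpha>\<close>, then \<open>a\<close> is far from the
  average of \<open>b\<close> on that set, which costs about \<open>\<alpha> (h - h\<^sub>0)\<close>.
\<close>

lemma weighted_lower_bound:
  fixes P :: "'i \<Rightarrow> real" and Q :: "'j \<Rightarrow> real"
  assumes P: "\<And>i. i \<in> I \<Longrightarrow> P i \<ge> 0" "sum P I = 1"
    and Q: "\<And>j. j \<in> J \<Longrightarrow> Q j \<ge> 0" "sum Q J = 1"
    and r: "\<And>i j. i \<in> I \<Longrightarrow> j \<in> J \<Longrightarrow> \<bar>a i - b j\<bar> / 2 \<le> r i j"
    and c: "\<And>i j. i \<in> I \<Longrightarrow> j \<in> J \<Longrightarrow> a i \<ge> h0 \<Longrightarrow> b j \<ge> h0 \<Longrightarrow> c \<le> r i j"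
    and c0: "0 \<le> c" and h: "h0 < h"
    and a: "h \<le> (\<Sum>i\<in>I. P i * a i)" and b: "h \<le> (\<Sum>j\<in>J. Q j * b j)"
  shows "c - 4 * c\<^sup>2 / (h - h0) \<le> (\<Sum>i\<in>I. \<Sum>j\<in>J. P i * Q j * r i j)"
proof -
  define D where "D = (\<Sum>i\<in>I. \<Sum>j\<in>J. P i * Q j * r i j)"
  define \<alpha> where "\<alpha> = (\<Sum>i\<in>I. P i * of_bool (a i < h0))"
  define \<beta> where "\<beta> = (\<Sum>j\<in>J. Q j * of_bool (b j < h0))"
  show ?thesis
  proof (cases "c \<le> D")
    case True
    have "4 * c\<^sup>2 / (h - h0) \<ge> 0" using h by simp
    thus ?thesis using True by (simp add: D_def)
  next
    case False
    have D2: "D = (\<Sum>j\<in>J. \<Sum>i\<in>I. P i * Q j * r i j)"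
      unfolding D_def by (rule sum.swap)
    have "\<alpha> * (h - h0) = (\<Sum>i\<in>I. P i * ((h - h0) * of_bool (a i < h0)))"
      by (simp add: \<alpha>_def sum_distrib_left mult_ac)
    also have "\<dots> \<le> (\<Sum>i\<in>I. P i * (\<Sum>j\<in>J. Q j * (2 * r i j)))"
    proof (intro sum_mono mult_left_mono P(1))
      fix i assume i: "i \<in> I"
      \<comment> \<open>Where \<open>a i < h0\<close>, it misses the average of \<open>b\<close>,
        which is at least \<open>h\<close>, by more than \<open>h - h0\<close>; elsewhere the left
        side vanishes.\<close>
      have "(h - h0) * of_bool (a i < h0) \<le> \<bar>a i - (\<Sum>j\<in>J. Q j * b j)\<bar>"
        using b h by auto
      also have "a i - (\<Sum>j\<in>J. Q j * b j) = (\<Sum>j\<in>J. Q j * (a i - b j))"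
        using Q(2) by (simp add: right_diff_distrib sum_subtractf flip: sum_distrib_right)
      also have "\<bar>\<dots>\<bar> \<le> (\<Sum>j\<in>J. \<bar>Q j * (a i - b j)\<bar>)"
        by (rule sum_abs)
      also have "\<dots> \<le> (\<Sum>j\<in>J. Q j * (2 * r i j))"
      proof (intro sum_mono)
        fix j assume j: "j \<in> J"
        show "\<bar>Q j * (a i - b j)\<bar> \<le> Q j * (2 * r i j)"
          using Q(1)[OF j] r[OF i j] by (auto simp: abs_mult intro!: mult_left_mono)
      qed
      finally show "(h - h0) * of_bool (a i < h0) \<le> (\<Sum>j\<in>J. Q j * (2 * r i j))" .
    qed
    also have "\<dots> = 2 * D"
      by (simp add: D_def sum_distrib_left algebra_simps)
    finally have \<alpha>: "\<alpha> * (h - h0) \<le> 2 * c" using False by simp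
    have "\<beta> * (h - h0) = (\<Sum>j\<in>J. Q j * ((h - h0) * of_bool (b j < h0)))"
      by (simp add: \<beta>_def sum_distrib_left mult_ac)
    also have "\<dots> \<le> (\<Sum>j\<in>J. Q j * (\<Sum>i\<in>I. P i * (2 * r i j)))"
    proof (intro sum_mono mult_left_mono Q(1))
      fix j assume j: "j \<in> J"
      have "(h - h0) * of_bool (b j < h0) \<le> \<bar>(\<Sum>i\<in>I. P i * a i) - b j\<bar>"
        using a h by auto
      also have "(\<Sum>i\<in>I. P i * a i) - b j = (\<Sum>i\<in>I. P i * (a i - b j))"
        using P(2) by (simp add: right_diff_distrib sum_subtractf flip: sum_distrib_right)
      also have "\<bar>\<dots>\<bar> \<le> (\<Sum>i\<in>I. \<bar>P i * (a i - b j)\<bar>)"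
        by (rule sum_abs)
      also have "\<dots> \<le> (\<Sum>i\<in>I. P i * (2 * r i j))"
      proof (intro sum_mono)
        fix i assume i: "i \<in> I"
        show "\<bar>P i * (a i - b j)\<bar> \<le> P i * (2 * r i j)"
          using P(1)[OF i] r[OF i j] by (auto simp: abs_mult intro!: mult_left_mono)
      qed
      finally show "(h - h0) * of_bool (b j < h0) \<le> (\<Sum>i\<in>I. P i * (2 * r i j))" .
    qed
    also have "\<dots> = 2 * D"
      by (simp add: D2 sum_distrib_left algebra_simps)
    finally have \<beta>: "\<beta> * (h - h0) \<le> 2 * c" using False by simp
    have "(\<alpha> + \<beta>) \<le> 4 * c / (h - h0)"
      using \<alpha> \<beta> h by (simp add: field_simps)
    hence "c * (\<alpha> + \<beta>) \<le> c * (4 * c / (h - h0))"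
      using c0 by (rule mult_left_mono)
    hence "c - 4 * c\<^sup>2 / (h - h0) \<le> c * (1 - \<alpha> - \<beta>)"
      by (simp add: algebra_simps power2_eq_square)
    also have "\<dots> = (\<Sum>i\<in>I. \<Sum>j\<in>J. P i * Q j * (c * (1 - of_bool (a i < h0) - of_bool (b j < h0))))"
    proof -
      have "(\<Sum>i\<in>I. \<Sum>j\<in>J. P i * Q j * (c * (1 - of_bool (a i < h0) - of_bool (b j < h0))))
        = (\<Sum>i\<in>I. c * (P i * (1 - of_bool (a i < h0)) * sum Q J - P i * \<beta>))"
        unfolding \<beta>_def sum_distrib_left sum_subtractf[symmetric]
        by (intro sum.cong refl) (simp add: algebra_simps)
      also have "\<dots> = c * (sum P I - \<alpha> - sum P I * \<beta>)"
        unfolding \<alpha>_def Q(2) sum_distrib_right sum_subtractf[symmetric] sum_distrib_left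
        by (intro sum.cong refl) (simp add: algebra_simps)
      finally show ?thesis using P(2) by simp
    qed
    also have "\<dots> \<le> (\<Sum>i\<in>I. \<Sum>j\<in>J. P i * Q j * r i j)"
    proof (intro sum_mono mult_left_mono)
      fix i j assume ij: "i \<in> I" "j \<in> J"
      \<comment> \<open>If an indicator equals one, the left side of the goal is at most zero;
        otherwise the hypothesis \<open>c\<close> applies.\<close>
      have "r i j \<ge> 0" by (rule order_trans[OF _ r[OF ij]]) simp
      thus "c * (1 - of_bool (a i < h0) - of_bool (b j < h0)) \<le> r i j"
        using c[OF ij] c0 by (cases "a i < h0"; cases "b j < h0") auto
    qed (use P Q in auto)
    finally show ?thesis .
  qed
qed

lemma crdist_lower_bound:
  fixes f :: "'v \<Rightarrow> 'a::ab_group_add" and f' :: "'w \<Rightarrow> 'a"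
  assumes fin: "finite (set_pmf p)" "finite (set_pmf q)"
    and c: "\<And>X Y :: 'a pmf. finite (set_pmf X) \<Longrightarrow> finite (set_pmf Y) \<Longrightarrow>
      h0 \<le> shannon_entropy X \<Longrightarrow> h0 \<le> shannon_entropy Y \<Longrightarrow> c \<le> rdist X Y"
    and c0: "0 \<le> c" and h: "h0 < h"
    and f: "h \<le> ent p (\<lambda>w. (f w, g w)) - ent p g"
    and f': "h \<le> ent q (\<lambda>w. (f' w, g' w)) - ent q g'"
  shows "c - 4 * c\<^sup>2 / (h - h0) \<le> crdist p f g q f' g'"
  unfolding crdist_def
proof (rule weighted_lower_bound[where a = "\<lambda>i. ent (fibre p g i) f" and b = "\<lambda>j. ent (fibre q g' j) f'"])
  show "sum (pmf (map_pmf g p)) (g ` set_pmf p) = 1" "sum (pmf (map_pmf g' q)) (g' ` set_pmf q) = 1"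
    using fin by (auto intro!: sum_pmf_eq_1)
  show "h \<le> (\<Sum>i\<in>g ` set_pmf p. pmf (map_pmf g p) i * ent (fibre p g i) f)"
    "h \<le> (\<Sum>j\<in>g' ` set_pmf q. pmf (map_pmf g' q) j * ent (fibre q g' j) f')"
    using f f' ent_chain[OF fin(1), of f g] ent_chain[OF fin(2), of f' g'] by auto
  fix i j assume ij: "i \<in> g ` set_pmf p" "j \<in> g' ` set_pmf q"
  let ?X = "map_pmf f (fibre p g i)" and ?Y = "map_pmf f' (fibre q g' j)"
  have "set_pmf p \<inter> g -` {i} \<noteq> {}" "set_pmf q \<inter> g' -` {j} \<noteq> {}" using ij by auto
  hence finXY: "finite (set_pmf ?X)" "finite (set_pmf ?Y)" using fin by auto
  show "\<bar>ent (fibre p g i) f - ent (fibre q g' j) f'\<bar> / 2 \<le> rdist ?X ?Y"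
    using rdist_ge[OF finXY] by (simp add: ent_def)
  show "c \<le> rdist ?X ?Y" if "h0 \<le> ent (fibre p g i) f" "h0 \<le> ent (fibre q g' j) f'"
    using c[OF finXY] that by (simp add: ent_def)
qed (use c0 h in auto)

section \<open>Differences of independent copies and the fibring inequality\<close>

definition diff_pmf :: "'a::ab_group_add pmf \<Rightarrow> 'a pmf" where
  "diff_pmf X = map_pmf (\<lambda>w. fst w - snd w) (pair_pmf X X)"

lemma finite_diff_pmf: "finite (set_pmf X) \<Longrightarrow> finite (set_pmf (diff_pmf X))"
  by (simp add: diff_pmf_def)

lemma diff_pmf_symmetric: "map_pmf uminus (diff_pmf X) = diff_pmf X"
proof -
  have "map_pmf uminus (diff_pmf X) = map_pmf (\<lambda>w. snd w - fst w) (pair_pmf X X)"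
    by (simp add: diff_pmf_def map_pmf_comp)
  also have "\<dots> = map_pmf (\<lambda>w. snd w - fst w) (map_pmf (\<lambda>(x, y). (y, x)) (pair_pmf X X))"
    by (subst pair_commute_pmf) (rule refl)
  also have "\<dots> = diff_pmf X"
    by (simp add: diff_pmf_def map_pmf_comp case_prod_beta')
  finally show ?thesis .
qed

lemma entropy_diff_pmf: "shannon_entropy (diff_pmf X) = ent (pair_pmf X X) (\<lambda>w. fst w - snd w)"
  by (simp add: diff_pmf_def ent_def)

lemma entropy_diff_pmf_ge:
  assumes "finite (set_pmf X)"
  shows "shannon_entropy X \<le> shannon_entropy (diff_pmf X)"
  using ent_ge_fst[OF assms assms, of "\<lambda>w. fst w - snd w" "\<lambda>x. x"]
  by (simp add: entropy_diff_pmf ent_ident)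

text \<open>A Ruzsa triangle inequality: \<open>x1 - x2\<close> is a function of
  \<open>(x1 - y, x2 - y)\<close> and also of \<open>(x1, x2)\<close>, while these two pairs
  together determine all three variables. Submodularity over \<open>x1 - x2\<close> gives the
  bound.\<close>

lemma entropy_diff_pmf_le:
  assumes fin: "finite (set_pmf X)" "finite (set_pmf Y)"
  shows "shannon_entropy (diff_pmf X) \<le> shannon_entropy X + 2 * rdist X Y"
proof -
  let ?P = "pair_pmf (pair_pmf X X) Y"
  have finP: "finite (set_pmf ?P)" and finX: "finite (set_pmf (pair_pmf X X))" using fin by auto
  let ?f = "\<lambda>w. (fst (fst w) - snd w, snd (fst w) - snd w)"
  let ?h = "\<lambda>w. fst (fst w) - snd (fst w)"
  have XY: "ent ?P (\<lambda>w. g (fst w) - snd w) = ent (pair_pmf X Y) (\<lambda>w. fst w - snd w)"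
    if "map_pmf g (pair_pmf X X) = X" for g
  proof -
    have "map_pmf (\<lambda>w. (g (fst w), snd w)) ?P = pair_pmf X Y"
      using map_pair[of g "\<lambda>y. y" "pair_pmf X X" Y] that by (simp add: case_prod_beta')
    thus ?thesis using ent_map[of "\<lambda>w. (g (fst w), snd w)" ?P "\<lambda>w. fst w - snd w"] by simp
  qed
  have "ent ?P (\<lambda>w. (?f w, fst w, ?h w)) + ent ?P ?h \<le> ent ?P (\<lambda>w. (?f w, ?h w)) + ent ?P (\<lambda>w. (fst w, ?h w))"
    by (rule ent_submodular[OF finP])
  also have "ent ?P (\<lambda>w. (?f w, fst w, ?h w)) = ent ?P (\<lambda>w. (fst w, snd w))"
    by (rule ent_eq[OF finP]) auto
  also have "\<dots> = ent (pair_pmf X X) (\<lambda>w. w) + shannon_entropy Y"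
    using ent_pair[OF finX fin(2), of "\<lambda>w. w" "\<lambda>w. w"] by (simp add: ent_ident)
  also have "ent ?P (\<lambda>w. (fst w, ?h w)) = ent ?P (\<lambda>w. fst w)"
    by (rule ent_eq[OF finP]) auto
  also have "\<dots> = ent (pair_pmf X X) (\<lambda>w. w)"
    using ent_fst_pair[of "pair_pmf X X" Y "\<lambda>w. w"] by simp
  also have "ent ?P ?h = shannon_entropy (diff_pmf X)"
    by (simp add: entropy_diff_pmf flip: ent_fst_pair[of "pair_pmf X X" Y])
  also have "ent ?P (\<lambda>w. (?f w, ?h w)) = ent ?P ?f"
    using ent_graph[OF finP, of ?f "\<lambda>(a, b). a - b"] by simp
  also have "\<dots> \<le> ent ?P (\<lambda>w. fst (fst w) - snd w) + ent ?P (\<lambda>w. snd (fst w) - snd w)"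
    by (rule ent_subadditive[OF finP])
  also have "\<dots> = 2 * ent (pair_pmf X Y) (\<lambda>w. fst w - snd w)"
    by (simp add: XY map_fst_pair_pmf map_snd_pair_pmf)
  finally show ?thesis by (simp add: rdist_def field_simps)
qed

lemma ent_fst_diff:
  fixes X :: "'a::ab_group_add pmf"
  assumes "finite (set_pmf X)"
  shows "ent (pair_pmf X X) (\<lambda>w. (fst w, fst w - snd w)) = 2 * shannon_entropy X"
proof -
  have "ent (pair_pmf X X) (\<lambda>w. (fst w, fst w - snd w)) = ent (pair_pmf X X) (\<lambda>w. (fst w, snd w))"
    by (rule ent_diff_right) (simp add: assms)
  thus ?thesis using ent_pair[OF assms assms, of "\<lambda>x. x" "\<lambda>x. x"] by (simp add: ent_ident)
qed

text \<open>Submodularity for \<open>x1 - y1\<close> and the pair \<open>(x1 - x2, y1 - y2)\<close>,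
  over the difference of the entries of that pair. The latter is also
  \<open>(x1 - y1) - (x2 - y2)\<close>, so with \<open>x1 - y1\<close> it carries the information of
  two copies of \<open>x - y\<close>.\<close>

lemma rdist_diff_pmf_le:
  fixes X Y :: "'a::ab_group_add pmf"
  assumes fin: "finite (set_pmf X)" "finite (set_pmf Y)"
  shows "rdist (diff_pmf X) (diff_pmf Y)
    + crdist (pair_pmf X X) fst (\<lambda>w. fst w - snd w) (pair_pmf Y Y) fst (\<lambda>w. fst w - snd w) \<le> 2 * rdist X Y"
proof -
  let ?P = "pair_pmf (pair_pmf X X) (pair_pmf Y Y)"
  have finP: "finite (set_pmf ?P)" and finX: "finite (set_pmf (pair_pmf X X))" and finY: "finite (set_pmf (pair_pmf Y Y))"
    using fin by auto
  let ?A = "\<lambda>w. fst (fst w) - fst (snd w)" and ?B = "\<lambda>w. snd (fst w) - snd (snd w)"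
  let ?D = "\<lambda>w. (fst (fst w) - snd (fst w), fst (snd w) - snd (snd w))"
  let ?S = "\<lambda>w :: ('a \<times> 'a) \<times> 'a \<times> 'a. (fst (fst w) - snd (fst w)) - (fst (snd w) - snd (snd w))"
  have XY: "ent ?P (\<lambda>w. g (fst w) - g' (snd w)) = ent (pair_pmf X Y) (\<lambda>w. fst w - snd w)"
    if "map_pmf g (pair_pmf X X) = X" "map_pmf g' (pair_pmf Y Y) = Y" for g g'
  proof -
    have "map_pmf (\<lambda>w. (g (fst w), g' (snd w))) ?P = pair_pmf X Y"
      using map_pair[of g g' "pair_pmf X X" "pair_pmf Y Y"] that by (simp add: case_prod_beta')
    thus ?thesis using ent_map[of "\<lambda>w. (g (fst w), g' (snd w))" ?P "\<lambda>w. fst w - snd w"] by simp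
  qed
  have "pair_pmf (diff_pmf X) (diff_pmf Y) = map_pmf ?D ?P"
    using map_pair[of "\<lambda>w. fst w - snd w" "\<lambda>w. fst w - snd w" "pair_pmf X X" "pair_pmf Y Y"]
    by (simp add: diff_pmf_def case_prod_beta')
  hence rd: "rdist (diff_pmf X) (diff_pmf Y) = ent ?P ?S - (shannon_entropy (diff_pmf X) + shannon_entropy (diff_pmf Y)) / 2"
    by (simp add: rdist_def ent_map)
  have cr: "crdist (pair_pmf X X) fst (\<lambda>w. fst w - snd w) (pair_pmf Y Y) fst (\<lambda>w. fst w - snd w)
    = ent ?P (\<lambda>w. (?A w, ?D w)) - shannon_entropy (diff_pmf X) - shannon_entropy (diff_pmf Y)
      - (2 * shannon_entropy X - shannon_entropy (diff_pmf X) + (2 * shannon_entropy Y - shannon_entropy (diff_pmf Y))) / 2"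
    using crdist_altdef[OF finX finY, of fst "\<lambda>w. fst w - snd w" fst "\<lambda>w. fst w - snd w"]
    by (simp add: entropy_diff_pmf ent_fst_diff[OF fin(1)] ent_fst_diff[OF fin(2)])
  have "ent ?P (\<lambda>w. (?A w, ?D w, ?S w)) + ent ?P ?S \<le> ent ?P (\<lambda>w. (?A w, ?S w)) + ent ?P (\<lambda>w. (?D w, ?S w))"
    by (rule ent_submodular[OF finP])
  also have "ent ?P (\<lambda>w. (?A w, ?D w, ?S w)) = ent ?P (\<lambda>w. (?A w, ?D w))"
    by (rule ent_eq[OF finP]) auto
  also have "ent ?P (\<lambda>w. (?D w, ?S w)) = ent ?P ?D"
    by (rule ent_eq[OF finP]) auto
  also have "\<dots> = shannon_entropy (diff_pmf X) + shannon_entropy (diff_pmf Y)"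
    using ent_pair[OF finX finY, of "\<lambda>w. fst w - snd w" "\<lambda>w. fst w - snd w"] by (simp add: entropy_diff_pmf)
  also have "?S = (\<lambda>w. ?A w - ?B w)"
    by (rule ext) (simp add: algebra_simps)
  also have "ent ?P (\<lambda>w. (?A w, ?A w - ?B w)) = ent ?P (\<lambda>w. (?A w, ?B w))"
    by (rule ent_diff_right[OF finP])
  also have "\<dots> \<le> ent ?P ?A + ent ?P ?B"
    by (rule ent_subadditive[OF finP])
  also have "\<dots> = 2 * ent (pair_pmf X Y) (\<lambda>w. fst w - snd w)"
    using XY[of fst fst] XY[of snd snd] by (simp add: map_fst_pair_pmf map_snd_pair_pmf)
  finally show ?thesis unfolding rd cr by (simp add: rdist_def field_simps)
qed

section \<open>Residues of integer random variables\<close>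

definition mod_ent :: "int \<Rightarrow> int pmf \<Rightarrow> real" where
  "mod_ent n X = ent X (\<lambda>x. x mod n)"

text \<open>The Ruzsa distance of the residues in the group of integers modulo \<open>n\<close>,
  written with representatives instead of a quotient group.\<close>

definition mod_rdist :: "int \<Rightarrow> int pmf \<Rightarrow> int pmf \<Rightarrow> real" where
  "mod_rdist n X Y = ent (pair_pmf X Y) (\<lambda>w. (fst w - snd w) mod n) - (mod_ent n X + mod_ent n Y) / 2"

text \<open>The fibring inequality for reduction modulo \<open>n\<close>: submodularity for the
  difference and the pair of residues, over the residue of the difference.\<close>

lemma rdist_ge_mod:
  assumes fin: "finite (set_pmf X)" "finite (set_pmf Y)"
  shows "mod_rdist n X Y + crdist X (\<lambda>x. x) (\<lambda>x. x mod n) Y (\<lambda>x. x) (\<lambda>x. x mod n) \<le> rdist X Y"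
proof -
  let ?P = "pair_pmf X Y"
  have finP: "finite (set_pmf ?P)" using fin by auto
  let ?A = "\<lambda>w. fst w - snd w" and ?D = "\<lambda>w. (fst w mod n, snd w mod n)" and ?S = "\<lambda>w. (fst w - snd w) mod n"
  have *: "ent Z (\<lambda>x. (x, x mod n)) = shannon_entropy Z" if "finite (set_pmf Z)" for Z
    unfolding ent_ident[symmetric] by (rule ent_eq[OF that]) auto
  have "ent ?P (\<lambda>w. (?A w, ?D w, ?S w)) + ent ?P ?S \<le> ent ?P (\<lambda>w. (?A w, ?S w)) + ent ?P (\<lambda>w. (?D w, ?S w))"
    by (rule ent_submodular[OF finP])
  also have "ent ?P (\<lambda>w. (?A w, ?D w, ?S w)) = ent ?P (\<lambda>w. (?A w, ?D w))"
    by (rule ent_eq[OF finP]) auto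
  also have "ent ?P (\<lambda>w. (?D w, ?S w)) = ent ?P ?D"
    by (rule ent_eq[OF finP]) (auto intro: mod_diff_cong)
  also have "\<dots> = mod_ent n X + mod_ent n Y"
    unfolding mod_ent_def by (rule ent_pair[OF fin])
  also have "ent ?P (\<lambda>w. (?A w, ?S w)) = ent ?P ?A"
    by (rule ent_eq[OF finP]) auto
  finally show ?thesis
    by (simp add: crdist_altdef[OF fin] * fin mod_rdist_def rdist_def mod_ent_def field_simps)
qed

text \<open>
  Since \<open>x + y\<close> and \<open>x - y\<close> differ by \<open>2 y\<close>, the residue of \<open>x + y\<close> modulo \<open>2 n\<close> is determined by
  those of \<open>x - y\<close> modulo \<open>2 n\<close> and of \<open>y\<close> modulo \<open>n\<close>. Hence, if the latter carries little
  information, sum and difference share the information of \<open>x + y\<close> modulo \<open>2 n\<close>.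
\<close>

lemma two_rdist_ge_parity:
  assumes fin: "finite (set_pmf X)" "finite (set_pmf Y)"
    and sym: "map_pmf uminus Y = Y"
  shows "mod_ent (2 * n) X - mod_ent n Y \<le> 2 * rdist X Y"
proof -
  let ?P = "pair_pmf X Y"
  have finP: "finite (set_pmf ?P)" using fin by auto
  let ?s = "\<lambda>w. fst w + snd w" and ?d = "\<lambda>w. fst w - snd w" and ?m = "\<lambda>x::int. x mod (2 * n)"
  \<comment> \<open>The symmetry of \<open>Y\<close> gives sum and difference the same
    entropy.\<close>
  have "ent ?P ?s = ent (pair_pmf X (map_pmf uminus Y)) ?s"
    by (simp add: sym)
  also have "pair_pmf X (map_pmf uminus Y) = map_pmf (\<lambda>w. (fst w, - snd w)) ?P"
    using map_pair[of "\<lambda>x. x" uminus X Y] by (simp add: case_prod_beta')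
  finally have sd: "ent ?P ?s = ent ?P ?d" by (simp add: ent_map)
  have "shannon_entropy X + shannon_entropy Y = ent ?P (\<lambda>w. (fst w, snd w))"
    using ent_pair[OF fin, of "\<lambda>x. x" "\<lambda>x. x"] by (simp add: ent_ident)
  also have "\<dots> = ent ?P (\<lambda>w. (?d w, ?s w))"
    by (rule ent_eq[OF finP]) auto
  \<comment> \<open>Here and in the next application of data processing, sum and difference are
    replaced in turn by their residues, so the residues share at most the information shared by sum
    and difference.\<close>
  finally have "shannon_entropy X + shannon_entropy Y + ent ?P (\<lambda>w. ?m (?d w))
      \<le> ent ?P (\<lambda>w. (?m (?d w), ?s w)) + ent ?P ?d"
    using ent_data_processing[OF finP, of ?d ?s ?m] by simp
  moreover have "ent ?P (\<lambda>w. (?m (?d w), ?s w)) = ent ?P (\<lambda>w. (?s w, ?m (?d w)))"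
    by (rule ent_eq[OF finP]) auto
  moreover have "ent ?P (\<lambda>w. (?s w, ?m (?d w))) + ent ?P (\<lambda>w. ?m (?s w))
      \<le> ent ?P (\<lambda>w. (?m (?s w), ?m (?d w))) + ent ?P ?s"
    by (rule ent_data_processing[OF finP])
  moreover have "ent ?P (\<lambda>w. (?m (?s w), ?m (?d w))) \<le> ent ?P (\<lambda>w. (?m (?d w), snd w mod n))"
  proof (rule ent_mono[OF finP])
    fix w w' :: "int \<times> int"
    assume eq: "(?m (?d w), snd w mod n) = (?m (?d w'), snd w' mod n)"
    hence "n dvd snd w - snd w'" by (auto simp: mod_eq_dvd_iff)
    hence "2 * n dvd 2 * (snd w - snd w')" by (rule mult_dvd_mono[OF dvd_refl])
    moreover have "2 * n dvd ?d w - ?d w'" using eq by (auto simp: mod_eq_dvd_iff)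
    ultimately have "2 * n dvd (?d w - ?d w') + 2 * (snd w - snd w')" by (rule dvd_add[rotated])
    also have "(?d w - ?d w') + 2 * (snd w - snd w') = ?s w - ?s w'" by simp
    finally show "(?m (?s w), ?m (?d w)) = (?m (?s w'), ?m (?d w'))"
      using eq by (auto simp: mod_eq_dvd_iff)
  qed
  moreover have "ent ?P (\<lambda>w. (?m (?d w), snd w mod n)) \<le> ent ?P (\<lambda>w. ?m (?d w)) + mod_ent n Y"
    using ent_subadditive[OF finP, of "\<lambda>w. ?m (?d w)" "\<lambda>w. snd w mod n"]
    using ent_snd_pair[of X Y "\<lambda>y. y mod n"] by (simp add: mod_ent_def)
  moreover have "mod_ent (2 * n) X \<le> ent ?P (\<lambda>w. ?m (?s w))"
    unfolding mod_ent_def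
    by (rule ent_ge_fst[OF fin]) (auto simp: mod_eq_dvd_iff)
  ultimately show ?thesis using sd by (simp add: rdist_def field_simps)
qed

section \<open>Nearly independent residues\<close>

text \<open>
  The mutual information dominates the squared Hellinger distance between the joint law and the
  product of the marginals, here restricted to a single cell.
\<close>

lemma mutual_information_ge_cell:
  assumes fin: "finite (set_pmf p)"
  shows "(sqrt (pmf (map_pmf (\<lambda>w. (f w, g w)) p) (a0, b0)) - sqrt (pmf (map_pmf f p) a0 * pmf (map_pmf g p) b0))\<^sup>2
    \<le> ent p f + ent p g - ent p (\<lambda>w. (f w, g w))"
proof -
  let ?S = "set_pmf p"
  let ?A = "f ` ?S" and ?B = "g ` ?S"
  let ?T = "(\<lambda>w. (f w, g w)) ` ?S"
  define F where "F = pmf (map_pmf f p)"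
  define K where "K = pmf (map_pmf g p)"
  define J where "J = pmf (map_pmf (\<lambda>w. (f w, g w)) p)"
  have pos: "F (f w) > 0" "K (g w) > 0" "J (f w, g w) > 0" if "w \<in> ?S" for w
    using pmf_map_pos[OF that, of f] pmf_map_pos[OF that, of g] pmf_map_pos[OF that, of "\<lambda>w. (f w, g w)"]
    by (auto simp: F_def K_def J_def)
  have nonneg [simp]: "F a \<ge> 0" "K b \<ge> 0" "J t \<ge> 0" for a b t
    by (auto simp: F_def K_def J_def)
  have J0: "J t = 0" if "t \<notin> ?T" for t
    using that by (auto simp: J_def pmf_eq_0_set_pmf)
  have FK: "sum F ?A = 1" "sum K ?B = 1"
    using fin by (auto simp: F_def K_def intro!: sum_pmf_eq_1)
  \<comment> \<open>On the joint support, \<open>J * R\<close> is the geometric mean of the joint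
    law and the product law, as in the Hellinger affinity.\<close>
  define R where "R = (\<lambda>(a, b). sqrt (F a * K b / J (a, b)))"
  have sub: "?T \<subseteq> ?A \<times> ?B" by auto
  have "(\<Sum>(a, b)\<in>?A \<times> ?B. (sqrt (J (a, b)) - sqrt (F a * K b))\<^sup>2)
      = (\<Sum>(a, b)\<in>?A \<times> ?B. J (a, b) + F a * K b - 2 * sqrt (J (a, b) * (F a * K b)))"
    by (intro sum.cong refl) (simp add: power2_diff real_sqrt_mult power_mult_distrib split: prod.splits)
  also have "\<dots> = sum J (?A \<times> ?B) + (\<Sum>(a, b)\<in>?A \<times> ?B. F a * K b)
      - 2 * (\<Sum>(a, b)\<in>?A \<times> ?B. sqrt (J (a, b) * (F a * K b)))"
    by (simp add: sum.distrib sum_subtractf sum_distrib_left case_prod_beta')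
  also have "(\<Sum>(a, b)\<in>?A \<times> ?B. F a * K b) = sum F ?A * sum K ?B"
    by (simp add: sum_product sum.cartesian_product)
  also have "sum J (?A \<times> ?B) = 1"
    unfolding J_def using fin by (intro sum_pmf_eq_1) auto
  also have "(\<Sum>(a, b)\<in>?A \<times> ?B. sqrt (J (a, b) * (F a * K b))) = (\<Sum>(a, b)\<in>?T. sqrt (J (a, b) * (F a * K b)))"
    using fin sub J0 by (intro sum.mono_neutral_right) auto
  also have "\<dots> = (\<Sum>t\<in>?T. J t * R t)"
  proof (intro sum.cong refl)
    fix t assume "t \<in> ?T"
    then obtain w where w: "w \<in> ?S" "t = (f w, g w)" by auto
    have "J t * (F (f w) * K (g w)) = (J t)\<^sup>2 * (F (f w) * K (g w) / J t)"
      using pos[OF w(1)] w(2) by (simp add: power2_eq_square)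
    hence "sqrt (J t * (F (f w) * K (g w))) = sqrt ((J t)\<^sup>2) * sqrt (F (f w) * K (g w) / J t)"
      by (simp only: real_sqrt_mult)
    thus "(case t of (a, b) \<Rightarrow> sqrt (J (a, b) * (F a * K b))) = J t * R t"
      using w(2) by (simp add: R_def)
  qed
  also have "\<dots> = (\<Sum>w\<in>?S. pmf p w * R (f w, g w))"
    using sum_map_pmf[OF fin, of "\<lambda>w. (f w, g w)" R] by (simp add: J_def)
  finally have hell: "(\<Sum>(a, b)\<in>?A \<times> ?B. (sqrt (J (a, b)) - sqrt (F a * K b))\<^sup>2)
      = 2 - 2 * (\<Sum>w\<in>?S. pmf p w * R (f w, g w))"
    using FK by simp
  have "2 - 2 * (\<Sum>w\<in>?S. pmf p w * R (f w, g w)) = (\<Sum>w\<in>?S. pmf p w * (2 - 2 * R (f w, g w)))"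
    using sum_pmf_eq_1[OF fin order_refl]
    by (simp add: right_diff_distrib sum_subtractf sum_distrib_left mult.left_commute flip: sum_distrib_right)
  also have "\<dots> \<le> (\<Sum>w\<in>?S. pmf p w * (ln (1 / F (f w)) + ln (1 / K (g w)) - ln (1 / J (f w, g w))))"
  proof (intro sum_mono mult_left_mono)
    fix w assume w: "w \<in> ?S"
    have R: "R (f w, g w) > 0" using pos[OF w] by (simp add: R_def)
    have "ln (1 / F (f w)) + ln (1 / K (g w)) - ln (1 / J (f w, g w)) = - ln (F (f w) * K (g w) / J (f w, g w))"
      using pos[OF w] by (simp add: ln_div ln_mult)
    also have "F (f w) * K (g w) / J (f w, g w) = (R (f w, g w))\<^sup>2"
      using pos[OF w] by (simp add: R_def)
    also have "- ln ((R (f w, g w))\<^sup>2) = - 2 * ln (R (f w, g w))"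
      using R by (simp add: ln_realpow)
    finally show "2 - 2 * R (f w, g w) \<le> ln (1 / F (f w)) + ln (1 / K (g w)) - ln (1 / J (f w, g w))"
      using ln_le_minus_one[OF R] by simp
  qed auto
  also have "\<dots> = ent p f + ent p g - ent p (\<lambda>w. (f w, g w))"
    unfolding ent_expectation[OF fin] F_def K_def J_def
    by (simp add: sum.distrib sum_subtractf algebra_simps)
  finally have le: "(\<Sum>(a, b)\<in>?A \<times> ?B. (sqrt (J (a, b)) - sqrt (F a * K b))\<^sup>2) \<le> \<dots>"
    using hell by simp
  have "(sqrt (J (a0, b0)) - sqrt (F a0 * K b0))\<^sup>2
    \<le> (\<Sum>(a, b)\<in>?A \<times> ?B. (sqrt (J (a, b)) - sqrt (F a * K b))\<^sup>2)"
  proof (cases "(a0, b0) \<in> ?A \<times> ?B")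
    case True
    have "(case (a0, b0) of (a, b) \<Rightarrow> (sqrt (J (a, b)) - sqrt (F a * K b))\<^sup>2)
        \<le> (\<Sum>(a, b)\<in>?A \<times> ?B. (sqrt (J (a, b)) - sqrt (F a * K b))\<^sup>2)"
      using fin by (intro member_le_sum[OF True]) auto
    thus ?thesis by simp
  next
    case False
    hence "F a0 = 0 \<or> K b0 = 0" by (auto simp: F_def K_def pmf_eq_0_set_pmf)
    moreover have "J (a0, b0) = 0" using False by (intro J0) auto
    moreover have "0 \<le> (\<Sum>(a, b)\<in>?A \<times> ?B. (sqrt (J (a, b)) - sqrt (F a * K b))\<^sup>2)"
      by (intro sum_nonneg) auto
    ultimately show ?thesis by auto
  qed
  thus ?thesis using le by (simp add: F_def K_def J_def)
qed

text \<open>Data processing passes to the two indicators, whose cell \<open>(True, True)\<close> has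
  joint weight \<open>J\<close> and product weight \<open>M\<close>. The factor \<open>4\<close>
  comes from \<open>J - M = (sqrt J - sqrt M) * (sqrt J + sqrt M)\<close> with last factor at most
  \<open>2\<close>.\<close>

lemma mutual_information_ge_covariance:
  assumes fin: "finite (set_pmf p)"
  shows "(measure p {w. f w \<in> A \<and> g w \<in> B} - measure p {w. f w \<in> A} * measure p {w. g w \<in> B})\<^sup>2
    \<le> 4 * (ent p f + ent p g - ent p (\<lambda>w. (f w, g w)))"
proof -
  let ?f = "\<lambda>w. f w \<in> A" and ?g = "\<lambda>w. g w \<in> B"
  define J where "J = measure p {w. f w \<in> A \<and> g w \<in> B}"
  define M where "M = measure p {w. f w \<in> A} * measure p {w. g w \<in> B}"
  have nonneg: "J \<ge> 0" "M \<ge> 0" by (auto simp: J_def M_def)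
  have le1: "J \<le> 1" "M \<le> 1" by (auto simp: J_def M_def intro!: mult_le_one)
  have pm: "pmf (map_pmf (\<lambda>w. (?f w, ?g w)) p) (True, True) = J"
    "pmf (map_pmf ?f p) True * pmf (map_pmf ?g p) True = M"
    by (auto simp: pmf_map J_def M_def vimage_def)
  have "(sqrt J + sqrt M)\<^sup>2 \<le> (1 + 1)\<^sup>2"
    using nonneg le1 by (intro power_mono add_mono) auto
  moreover have "J - M = (sqrt J - sqrt M) * (sqrt J + sqrt M)"
    using nonneg by (simp add: algebra_simps)
  ultimately have "(J - M)\<^sup>2 \<le> (sqrt J - sqrt M)\<^sup>2 * 4"
    by (simp add: power_mult_distrib mult_left_mono)
  also have "(sqrt J - sqrt M)\<^sup>2 \<le> ent p ?f + ent p ?g - ent p (\<lambda>w. (?f w, ?g w))"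
    using mutual_information_ge_cell[OF fin, of ?f ?g True True] unfolding pm .
  also have "\<dots> \<le> ent p f + ent p g - ent p (\<lambda>w. (f w, g w))"
  proof -
    have "ent p (\<lambda>w. (f w, g w)) + ent p ?f \<le> ent p (\<lambda>w. (?f w, g w)) + ent p f"
      by (rule ent_data_processing[OF fin])
    moreover have "ent p (\<lambda>w. (g w, ?f w)) + ent p ?g \<le> ent p (\<lambda>w. (?g w, ?f w)) + ent p g"
      by (rule ent_data_processing[OF fin])
    moreover have "ent p (\<lambda>w. (g w, ?f w)) = ent p (\<lambda>w. (?f w, g w))"
      "ent p (\<lambda>w. (?g w, ?f w)) = ent p (\<lambda>w. (?f w, ?g w))"
      by (intro ent_eq[OF fin]; auto)+
    ultimately show ?thesis by simp
  qed
  finally show ?thesis by (simp add: J_def M_def)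
qed

section \<open>Atoms and balanced events\<close>

lemma entropy_ge_max_atom:
  assumes fin: "finite (set_pmf p)"
  shows "\<exists>x\<in>set_pmf p. exp (- shannon_entropy p) \<le> pmf p x"
proof (rule ccontr)
  assume "\<not> ?thesis"
  hence less: "pmf p x < exp (- shannon_entropy p)" if "x \<in> set_pmf p" for x using that by force
  \<comment> \<open>The entropy is an average of \<open>ln (1 / pmf p x)\<close>, so these values
    cannot all exceed it.\<close>
  have "shannon_entropy p = (\<Sum>x\<in>set_pmf p. pmf p x * shannon_entropy p)"
    using sum_pmf_eq_1[OF fin order_refl] by (simp flip: sum_distrib_right)
  also have "\<dots> < (\<Sum>x\<in>set_pmf p. pmf p x * ln (1 / pmf p x))"
  proof (intro sum_strict_mono mult_strict_left_mono fin set_pmf_not_empty)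
    fix x assume x: "x \<in> set_pmf p"
    show pos: "pmf p x > 0" by (rule pmf_positive[OF x])
    have "ln (pmf p x) < ln (exp (- shannon_entropy p))"
      using less[OF x] pos by (subst ln_less_cancel_iff) auto
    thus "shannon_entropy p < ln (1 / pmf p x)" using pos by (simp add: ln_div)
  qed
  finally show False by (simp add: shannon_entropy_def)
qed

text \<open>If all atoms weigh at most \<open>1 / 4\<close>, a maximal event of weight at most \<open>1 / 2\<close> is balanced.\<close>

lemma atom_if_no_balanced_event:
  assumes fin: "finite (set_pmf p)"
    and E: "\<And>E. measure p E * (1 - measure p E) \<le> \<theta>"
    and \<theta>: "\<theta> < 3 / 16"
  shows "\<exists>x\<in>set_pmf p. 1 - 2 * \<theta> \<le> pmf p x"
proof (rule ccontr)
  assume no: "\<not> ?thesis"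
  have small: "pmf p x \<le> 1 / 4" if x: "x \<in> set_pmf p" for x
  proof (rule ccontr)
    assume big: "\<not> ?thesis"
    have le: "pmf p x * (1 - pmf p x) \<le> \<theta>"
      using E[of "{x}"] by (simp add: measure_pmf_single)
    \<comment> \<open>\<open>t * (1 - t)\<close> is at least \<open>3 / 16\<close> for
      \<open>t\<close> between \<open>1 / 4\<close> and \<open>3 / 4\<close>, which the bound on
      \<open>\<theta>\<close> excludes.\<close>
    have "pmf p x \<ge> 1 / 2"
    proof (rule ccontr)
      assume "\<not> ?thesis"
      hence "(pmf p x - 1 / 4) * (3 / 4 - pmf p x) \<ge> 0" using big by (intro mult_nonneg_nonneg) auto
      thus False using le \<theta> by (simp add: algebra_simps)
    qed
    hence "1 / 2 * (1 - pmf p x) \<le> pmf p x * (1 - pmf p x)"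
      by (intro mult_right_mono) (auto simp: pmf_le_1)
    thus False using le no x by force
  qed
  define \<E> where "\<E> = {E. E \<subseteq> set_pmf p \<and> measure p E \<le> 1 / 2}"
  have "finite \<E>" "{} \<in> \<E>" using fin by (auto simp: \<E>_def)
  then obtain M where M: "M \<in> \<E>" "\<And>E. E \<in> \<E> \<Longrightarrow> M \<subseteq> E \<Longrightarrow> E = M"
    using finite_has_maximal[of \<E>] by blast
  have "measure p (set_pmf p) = 1" by (simp add: measure_measure_pmf_finite[OF fin] sum_pmf_eq_1[OF fin])
  hence "M \<noteq> set_pmf p" using M(1) by (auto simp: \<E>_def)
  then obtain x where x: "x \<in> set_pmf p" "x \<notin> M" using M(1) by (auto simp: \<E>_def)
  have finM: "finite M" using M(1) fin finite_subset by (auto simp: \<E>_def)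
  have "insert x M \<notin> \<E>" using M(2)[of "insert x M"] x by auto
  hence "1 / 2 < measure p (insert x M)" using M(1) x by (auto simp: \<E>_def)
  also have "measure p (insert x M) = pmf p x + measure p M"
    using finM x(2) by (simp add: measure_measure_pmf_finite)
  finally have "measure p M > 1 / 4" using small[OF x(1)] by simp
  hence "(measure p M - 1 / 4) * (3 / 4 - measure p M) \<ge> 0"
    using M(1) by (intro mult_nonneg_nonneg) (auto simp: \<E>_def)
  thus False using E[of M] \<theta> by (simp add: algebra_simps)
qed

text \<open>A crude bound for binary entropy that avoids logarithms in the result and uses only
  \<open>ln x \<le> x - 1\<close>.\<close>

lemma ent_eq_atom_le:
  assumes x: "x \<in> set_pmf p" and \<theta>: "1 - \<theta> \<le> pmf p x" "0 \<le> \<theta>" "\<theta> \<le> 1"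
  shows "ent p (\<lambda>y. y = x) \<le> 3 * sqrt \<theta>"
proof -
  let ?q = "map_pmf (\<lambda>y. y = x) p"
  define m where "m = pmf p x"
  have m: "0 < m" "m \<le> 1" "1 - \<theta> \<le> m" using x \<theta> by (auto simp: m_def pmf_positive pmf_le_1)
  have T: "pmf ?q True = m" by (simp add: pmf_map m_def vimage_def measure_pmf_single)
  have "sum (pmf ?q) UNIV = 1" by (rule sum_pmf_eq_1) auto
  hence F: "pmf ?q False = 1 - m" using T by (simp add: UNIV_bool)
  have "ent p (\<lambda>y. y = x) = (\<Sum>b\<in>set_pmf ?q. pmf ?q b * ln (1 / pmf ?q b))"
    by (simp only: ent_def shannon_entropy_def)
  also have "\<dots> = (\<Sum>b\<in>UNIV. pmf ?q b * ln (1 / pmf ?q b))"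
    by (intro sum.mono_neutral_left) (auto simp: pmf_eq_0_set_pmf)
  also have "\<dots> = m * ln (1 / m) + (1 - m) * ln (1 / (1 - m))"
    by (simp add: UNIV_bool T F)
  finally have ent: "ent p (\<lambda>y. y = x) = m * ln (1 / m) + (1 - m) * ln (1 / (1 - m))" .
  have "m * ln (1 / m) \<le> m * (1 / m - 1)"
    using m by (intro mult_left_mono ln_le_minus_one) auto
  also have "\<dots> = 1 - m" using m by (simp add: field_simps)
  also have "1 - m \<le> sqrt \<theta>"
  proof -
    have "\<theta> * \<theta> \<le> \<theta> * 1" using \<theta> by (intro mult_left_mono) auto
    hence "\<theta> \<le> sqrt \<theta>" using \<theta> by (intro real_le_rsqrt) (simp add: power2_eq_square)
    thus ?thesis using m by simp
  qed
  finally have 1: "m * ln (1 / m) \<le> sqrt \<theta>" .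
  have 2: "(1 - m) * ln (1 / (1 - m)) \<le> 2 * sqrt \<theta>"
  proof (cases "m = 1")
    case False
    \<comment> \<open>Taking the root first matters: \<open>ln x \<le> x - 1\<close> at
      \<open>1 / t\<^sup>2\<close> would only give \<open>1 - t\<^sup>2\<close>, which does not tend
      to zero with \<open>t\<close>.\<close>
    define t where "t = sqrt (1 - m)"
    have t: "t > 0" "1 - m = t\<^sup>2" using False m by (auto simp: t_def)
    have "t\<^sup>2 * ln (1 / t\<^sup>2) = t\<^sup>2 * (2 * ln (1 / t))"
      using t(1) by (simp add: ln_div ln_realpow)
    also have "\<dots> \<le> t\<^sup>2 * (2 * (1 / t - 1))"
      using t(1) by (intro mult_left_mono ln_le_minus_one) auto
    also have "\<dots> = 2 * t - 2 * t\<^sup>2" using t(1) by (simp add: field_simps power2_eq_square)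
    also have "\<dots> \<le> 2 * t" by simp
    also have "t \<le> sqrt \<theta>" using m by (simp add: t_def)
    finally show ?thesis using t(2) by simp
  qed (use \<theta> in auto)
  show ?thesis using ent 1 2 by simp
qed

text \<open>With \<open>F\<close> the residues \<open>x0 - y\<close> for \<open>y\<close> in
  \<open>E\<close>, the events \<open>x - y\<close> in \<open>F\<close> and \<open>y\<close> in
  \<open>E\<close> have covariance at least \<open>(2 * \<mu> - 1) * (q * (1 - q))\<close>. It is
  controlled by the mutual information of \<open>x - y\<close> and \<open>y\<close> modulo
  \<open>n\<close>, which is the entropy increase on the right.\<close>

lemma residue_balanced_event_bound:
  fixes n :: int and E :: "int set"
  assumes fin: "finite (set_pmf X)" "finite (set_pmf Y)"
    and m: "1 / 2 \<le> pmf (map_pmf (\<lambda>x. x mod n) X) x0"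
  defines "q \<equiv> measure (map_pmf (\<lambda>y. y mod n) Y) E"
  shows "((2 * pmf (map_pmf (\<lambda>x. x mod n) X) x0 - 1) * (q * (1 - q)))\<^sup>2
    \<le> 4 * (ent (pair_pmf X Y) (\<lambda>w. (fst w - snd w) mod n) - mod_ent n X)"
proof -
  let ?P = "pair_pmf X Y"
  let ?f = "\<lambda>w. (fst w - snd w) mod n" and ?g = "\<lambda>w. snd w mod n"
  have finP: "finite (set_pmf ?P)" using fin by simp
  define A where "A = {x. x mod n = x0}"
  define B where "B = {y. y mod n \<in> E}"
  define F where "F = {(x0 - y) mod n | y. y \<in> B}"
  define \<mu> where "\<mu> = measure X A"
  have \<mu>: "pmf (map_pmf (\<lambda>x. x mod n) X) x0 = \<mu>" "1 / 2 \<le> \<mu>" "\<mu> \<le> 1"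
    using m by (auto simp: \<mu>_def A_def pmf_map vimage_def)
  have q: "measure Y B = q" "0 \<le> q" "q \<le> 1"
    by (auto simp: q_def B_def vimage_def)
  define J where "J = measure ?P {w. ?f w \<in> F \<and> ?g w \<in> E}"
  have "\<mu> * q = measure ?P (A \<times> B)"
    by (simp add: measure_pair_pmf_Times \<mu>_def q(1))
  also have "\<dots> \<le> J"
    unfolding J_def
  proof (intro measure_pmf.finite_measure_mono subsetI CollectI conjI)
    fix w assume w: "w \<in> A \<times> B"
    hence "(fst w - snd w) mod n = (x0 - snd w) mod n"
      by (auto simp: A_def mod_diff_left_eq)
    thus "?f w \<in> F" using w by (auto simp: F_def)
  qed (auto simp: B_def)
  finally have J: "\<mu> * q \<le> J" .
  \<comment> \<open>If \<open>x\<close> has residue \<open>x0\<close>, then \<open>x - y\<close> in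
    \<open>F\<close> forces \<open>y\<close> in \<open>E\<close>. So the event can occur outside the
    joint one only when \<open>x\<close> misses \<open>x0\<close> and \<open>y\<close> misses
    \<open>E\<close>.\<close>
  have "measure ?P {w. ?f w \<in> F} \<le> measure ?P ({w. ?f w \<in> F \<and> ?g w \<in> E} \<union> (- A) \<times> (- B))"
  proof (intro measure_pmf.finite_measure_mono subsetI)
    fix w assume "w \<in> {w. ?f w \<in> F}"
    then obtain y where w: "?f w = (x0 - y) mod n" "y mod n \<in> E" by (auto simp: F_def B_def)
    have "snd w mod n \<in> E" if "fst w mod n = x0"
    proof -
      have "(fst w - snd w) mod n = (fst w - y) mod n"
        using w(1) that by (auto simp: mod_diff_left_eq)
      hence "snd w mod n = y mod n"
        by (auto simp: mod_eq_dvd_iff dvd_diff_commute)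
      thus ?thesis using w by simp
    qed
    thus "w \<in> {w. ?f w \<in> F \<and> ?g w \<in> E} \<union> (- A) \<times> (- B)"
      using \<open>w \<in> _\<close> by (cases w) (auto simp: A_def B_def)
  qed auto
  also have "\<dots> \<le> J + measure ?P ((- A) \<times> (- B))"
    unfolding J_def by (intro measure_Un_le) auto
  also have "measure ?P ((- A) \<times> (- B)) = (1 - \<mu>) * (1 - q)"
    using measure_pmf.prob_compl[of A X] measure_pmf.prob_compl[of B Y] q(1)
    by (simp add: measure_pair_pmf_Times \<mu>_def Compl_eq_Diff_UNIV)
  finally have F: "measure ?P {w. ?f w \<in> F} \<le> J + (1 - \<mu>) * (1 - q)" .
  have "measure ?P {w. ?g w \<in> E} = measure ?P (UNIV \<times> B)"
    by (rule arg_cong[where f = "measure ?P"]) (auto simp: B_def)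
  hence G: "measure ?P {w. ?g w \<in> E} = q" by (simp add: measure_pair_pmf_Times q(1))
  have "(2 * \<mu> - 1) * (q * (1 - q)) = \<mu> * q * (1 - q) - (1 - \<mu>) * (1 - q) * q"
    by (simp add: algebra_simps)
  also have "\<dots> \<le> J * (1 - q) - (1 - \<mu>) * (1 - q) * q"
    using J q by (intro diff_right_mono mult_right_mono) auto
  also have "\<dots> = J - (J + (1 - \<mu>) * (1 - q)) * q"
    by (simp add: algebra_simps)
  also have "\<dots> \<le> J - measure ?P {w. ?f w \<in> F} * measure ?P {w. ?g w \<in> E}"
    unfolding G using F q by (intro diff_left_mono mult_right_mono) auto
  finally have "((2 * \<mu> - 1) * (q * (1 - q)))\<^sup>2
      \<le> (J - measure ?P {w. ?f w \<in> F} * measure ?P {w. ?g w \<in> E})\<^sup>2"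
    using \<mu> q by (intro power_mono) auto
  also have "\<dots> \<le> 4 * (ent ?P ?f + ent ?P ?g - ent ?P (\<lambda>w. (?f w, ?g w)))"
    unfolding J_def by (rule mutual_information_ge_covariance[OF finP])
  also have "ent ?P ?g = mod_ent n Y"
    using ent_snd_pair[of X Y "\<lambda>y. y mod n"] by (simp add: mod_ent_def)
  also have "ent ?P (\<lambda>w. (?f w, ?g w)) = ent ?P (\<lambda>w. (fst w mod n, snd w mod n))"
  proof (rule ent_eq[OF finP])
    fix w w' :: "int \<times> int"
    have "(fst w - fst w') = (fst w - snd w - (fst w' - snd w')) + (snd w - snd w')"
      "(fst w - snd w - (fst w' - snd w')) = (fst w - fst w') - (snd w - snd w')"
      by simp_all
    hence "n dvd fst w - snd w - (fst w' - snd w') \<longleftrightarrow> n dvd fst w - fst w'" if "n dvd snd w - snd w'"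
      using that by (metis dvd_add dvd_diff)
    thus "(?f w, ?g w) = (?f w', ?g w') \<longleftrightarrow> (fst w mod n, snd w mod n) = (fst w' mod n, snd w' mod n)"
      by (auto simp: mod_eq_dvd_iff)
  qed
  also have "\<dots> = mod_ent n X + mod_ent n Y"
    unfolding mod_ent_def by (rule ent_pair[OF fin])
  finally show ?thesis by (simp add: \<mu>(1))
qed

text \<open>
  Conditioned on \<open>x mod n = x0\<close>, the difference has the entropy of \<open>y\<close>; conditioned on the
  complement, it still has at least the entropy of \<open>x\<close>.
\<close>

lemma residue_atom_bound:
  assumes fin: "finite (set_pmf X)" "finite (set_pmf Y)"
    and x0: "x0 \<in> set_pmf (map_pmf (\<lambda>x. x mod n) X)"
  shows "pmf (map_pmf (\<lambda>x. x mod n) X) x0 * mod_ent n Y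
    \<le> ent (pair_pmf X Y) (\<lambda>w. (fst w - snd w) mod n) - mod_ent n X + ent X (\<lambda>x. x mod n = x0)"
proof -
  let ?P = "pair_pmf X Y"
  let ?f = "\<lambda>w. (fst w - snd w) mod n" and ?a = "\<lambda>x. x mod n = x0" and ?b = "\<lambda>w. fst w mod n = x0"
  let ?N = "pmf (map_pmf ?a X)" and ?I = "?a ` set_pmf X"
  have finP: "finite (set_pmf ?P)" using fin by simp
  have mapb: "map_pmf ?b ?P = map_pmf ?a X"
    using map_pmf_comp[of ?a fst ?P] by (simp add: map_fst_pair_pmf)
  have imgb: "?b ` set_pmf ?P = ?I"
    using arg_cong[OF mapb, of set_pmf] by simp
  have True: "True \<in> ?I" using x0 by auto
  have "?N i * (ent (fibre X ?a i) (\<lambda>x. x mod n) + of_bool i * mod_ent n Y) \<le> ?N i * ent (fibre ?P ?b i) ?f"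
    if i: "i \<in> ?I" for i
  proof (rule mult_left_mono)
    have ne: "set_pmf X \<inter> ?a -` {i} \<noteq> {}" using i by auto
    have set: "set_pmf (fibre X ?a i) = {x \<in> set_pmf X. ?a x = i}" using set_cond_pmf[OF ne] by auto
    hence finX: "finite (set_pmf (fibre X ?a i))" using fin by simp
    have "fibre ?P ?b i = cond_pmf ?P ((?a -` {i}) \<times> UNIV)"
      by (rule arg_cong[where f = "cond_pmf ?P"]) (simp add: set_eq_iff)
    also have "\<dots> = pair_pmf (fibre X ?a i) (cond_pmf Y UNIV)"
      by (rule cond_pair_pmf[OF ne]) (simp add: set_pmf_not_empty)
    also have "\<dots> = pair_pmf (fibre X ?a i) Y"
      by (simp only: cond_pmf_UNIV)
    finally have fib: "fibre ?P ?b i = pair_pmf (fibre X ?a i) Y" .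
    have "ent (fibre X ?a i) (\<lambda>x. x mod n) \<le> ent (pair_pmf (fibre X ?a i) Y) ?f"
      by (rule ent_ge_fst[OF finX fin(2)]) (auto simp: mod_eq_dvd_iff)
    moreover have "mod_ent n Y \<le> ent (pair_pmf (fibre X ?a i) Y) ?f"
      unfolding mod_ent_def
      by (rule ent_ge_snd[OF finX fin(2)]) (auto simp: mod_eq_dvd_iff dvd_diff_commute)
    moreover have "ent (fibre X ?a i) (\<lambda>x. x mod n) = 0" if i
    proof -
      have "ent (fibre X ?a i) (\<lambda>x. x mod n) = ent (fibre X ?a i) (\<lambda>_. x0)"
        using set that by (intro ent_cong) auto
      thus ?thesis by (simp add: ent_const)
    qed
    ultimately show "ent (fibre X ?a i) (\<lambda>x. x mod n) + of_bool i * mod_ent n Y \<le> ent (fibre ?P ?b i) ?f"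
      unfolding fib by (cases i) auto
  qed simp
  hence "(\<Sum>i\<in>?I. ?N i * (ent (fibre X ?a i) (\<lambda>x. x mod n) + of_bool i * mod_ent n Y))
      \<le> (\<Sum>i\<in>?I. ?N i * ent (fibre ?P ?b i) ?f)"
    by (intro sum_mono)
  also have "(\<Sum>i\<in>?I. ?N i * (ent (fibre X ?a i) (\<lambda>x. x mod n) + of_bool i * mod_ent n Y))
    = (\<Sum>i\<in>?I. ?N i * ent (fibre X ?a i) (\<lambda>x. x mod n)) + (\<Sum>i\<in>?I. ?N i * of_bool i * mod_ent n Y)"
    by (simp add: algebra_simps sum.distrib)
  also have "(\<Sum>i\<in>?I. ?N i * of_bool i * mod_ent n Y) = (\<Sum>i\<in>{True}. ?N i * of_bool i * mod_ent n Y)"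
    using True fin by (intro sum.mono_neutral_right) auto
  \<comment> \<open>The indicator of \<open>x0\<close> is a function of the residue, so conditioning
    on it costs exactly its own entropy.\<close>
  also have "(\<Sum>i\<in>?I. ?N i * ent (fibre X ?a i) (\<lambda>x. x mod n)) = mod_ent n X - ent X ?a"
    using ent_chain[OF fin(1), of "\<lambda>x. x mod n" ?a] ent_graph[OF fin(1), of "\<lambda>x. x mod n" "\<lambda>r. r = x0"]
    by (simp add: mod_ent_def)
  also have "(\<Sum>i\<in>?I. ?N i * ent (fibre ?P ?b i) ?f) = ent ?P (\<lambda>w. (?f w, ?b w)) - ent ?P ?b"
    using ent_chain[OF finP, of ?f ?b] by (simp only: mapb imgb)
  also have "\<dots> \<le> ent ?P ?f"
    using ent_subadditive[OF finP, of ?f ?b] by simp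
  finally have "mod_ent n X - ent X ?a + ?N True * mod_ent n Y \<le> ent ?P ?f" by simp
  moreover have "?N True = pmf (map_pmf (\<lambda>x. x mod n) X) x0"
    by (simp add: pmf_map vimage_def)
  ultimately show ?thesis by simp
qed

section \<open>The entropy gap for residues at small distance\<close>

lemma mod_rdist_ge:
  assumes fin: "finite (set_pmf X)" "finite (set_pmf Y)"
  shows "mod_ent n X \<le> ent (pair_pmf X Y) (\<lambda>w. (fst w - snd w) mod n)"
    "mod_ent n Y \<le> ent (pair_pmf X Y) (\<lambda>w. (fst w - snd w) mod n)"
  unfolding mod_ent_def
  by (rule ent_ge_fst[OF fin], simp add: mod_eq_dvd_iff,
      rule ent_ge_snd[OF fin], simp add: mod_eq_dvd_iff dvd_diff_commute)

lemma mod_rdist_commute: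
  assumes "finite (set_pmf X)" "finite (set_pmf Y)"
  shows "mod_rdist n Y X = mod_rdist n X Y"
proof -
  have "ent (pair_pmf X Y) (\<lambda>w. (snd w - fst w) mod n) = ent (pair_pmf X Y) (\<lambda>w. (fst w - snd w) mod n)"
  proof (rule ent_eq)
    fix w w' :: "int \<times> int"
    have "snd w - fst w - (snd w' - fst w') = - (fst w - snd w - (fst w' - snd w'))" by simp
    thus "(snd w - fst w) mod n = (snd w' - fst w') mod n \<longleftrightarrow> (fst w - snd w) mod n = (fst w' - snd w') mod n"
      by (metis mod_eq_dvd_iff dvd_minus_iff)
  qed (use assms in simp)
  thus ?thesis by (simp add: mod_rdist_def ent_swap[of Y X])
qed

text \<open>Entropy below \<open>ln 2 - \<eta>\<close> yields a residue of \<open>X\<close> of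
  weight above \<open>1 / 2\<close> by a margin. Then no event for the residue of \<open>Y\<close>
  is balanced, so one residue of \<open>Y\<close> has almost full weight. The atom bound with the
  roles of \<open>X\<close> and \<open>Y\<close> exchanged makes the entropy of \<open>X\<close>
  small, and the distance passes this on to \<open>Y\<close>.\<close>

lemma small_mod_ent:
  assumes fin: "finite (set_pmf X)" "finite (set_pmf Y)"
    and \<eta>: "0 < \<eta>" "\<eta> \<le> 1" and \<theta>: "0 \<le> \<theta>" "\<theta> \<le> 1 / 8" "9 * sqrt (2 * \<theta>) \<le> \<eta>"
    and \<delta>: "\<delta> \<le> \<eta> / 18" "8 * \<delta> \<le> (\<eta> * \<theta>)\<^sup>2"
    and d: "mod_rdist n X Y \<le> \<delta>"
    and X: "mod_ent n X < ln 2 - \<eta>"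
  shows "mod_ent n X \<le> \<eta>" "mod_ent n Y \<le> \<eta>"
proof -
  define W where "W = ent (pair_pmf X Y) (\<lambda>w. (fst w - snd w) mod n)"
  let ?U = "map_pmf (\<lambda>x. x mod n) X" and ?V = "map_pmf (\<lambda>x. x mod n) Y"
  have finU: "finite (set_pmf ?U)" and finV: "finite (set_pmf ?V)" using fin by auto
  have W: "W - mod_ent n X \<le> 2 * \<delta>" "W - mod_ent n Y \<le> 2 * \<delta>" "mod_ent n X \<le> W" "mod_ent n Y \<le> W"
    using d mod_rdist_ge[OF fin, of n] by (auto simp: mod_rdist_def W_def field_simps)
  obtain x0 where x0: "exp (- shannon_entropy ?U) \<le> pmf ?U x0"
    using entropy_ge_max_atom[OF finU] by auto
  define m where "m = pmf ?U x0"
  have "(1 + \<eta>) / 2 \<le> exp \<eta> / 2"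
    by (intro divide_right_mono exp_ge_add_one_self) simp
  also have "\<dots> = exp (\<eta> - ln 2)" by (simp add: exp_diff)
  also have "\<dots> \<le> exp (- shannon_entropy ?U)" using X by (simp add: mod_ent_def ent_def)
  finally have m: "\<eta> \<le> 2 * m - 1" using x0 by (simp add: m_def)
  have "measure ?V E * (1 - measure ?V E) \<le> \<theta>" for E
  proof -
    define q where "q = measure ?V E"
    have q: "0 \<le> q" "q \<le> 1" by (auto simp: q_def)
    have "(\<eta> * (q * (1 - q)))\<^sup>2 \<le> ((2 * m - 1) * (q * (1 - q)))\<^sup>2"
      using m \<eta> q by (intro power_mono mult_right_mono mult_nonneg_nonneg) auto
    also have "\<dots> \<le> 4 * (W - mod_ent n X)"
      unfolding m_def q_def W_def
      by (rule residue_balanced_event_bound[OF fin]) (use m \<eta> in \<open>simp add: m_def\<close>)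
    also have "\<dots> \<le> (\<eta> * \<theta>)\<^sup>2" using W(1) \<delta>(2) by simp
    finally have "\<eta> * (q * (1 - q)) \<le> \<eta> * \<theta>"
      by (rule power2_le_imp_le) (use \<eta> \<theta> in simp)
    thus ?thesis using \<eta> by (simp add: q_def)
  qed
  then obtain y0 where y0: "y0 \<in> set_pmf ?V" "1 - 2 * \<theta> \<le> pmf ?V y0"
    using atom_if_no_balanced_event[OF finV, of \<theta>] \<theta> by auto
  \<comment> \<open>The factor \<open>3 / 4\<close> is at most \<open>1 - 2 * \<theta>\<close>, as
    \<open>\<theta> \<le> 1 / 8\<close>.\<close>
  have "3 / 4 * mod_ent n X \<le> pmf ?V y0 * mod_ent n X"
    using y0 \<theta> by (intro mult_right_mono) (auto simp: mod_ent_def ent_nonneg)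
  also have "\<dots> \<le> ent (pair_pmf Y X) (\<lambda>w. (fst w - snd w) mod n) - mod_ent n Y + ent Y (\<lambda>x. x mod n = y0)"
    by (rule residue_atom_bound[OF fin(2,1) y0(1)])
  also have "ent (pair_pmf Y X) (\<lambda>w. (fst w - snd w) mod n) = W"
    using mod_rdist_commute[OF fin, of n] by (simp add: mod_rdist_def W_def add.commute)
  also have "ent Y (\<lambda>x. x mod n = y0) = ent ?V (\<lambda>x. x = y0)"
    by (simp add: ent_map)
  also have "\<dots> \<le> 3 * sqrt (2 * \<theta>)"
    using \<theta> y0 by (intro ent_eq_atom_le) auto
  finally have "mod_ent n X \<le> 2 / 3 * \<eta>" using W(2) \<delta>(1) \<theta>(3) \<eta>(1) by simp
  thus "mod_ent n X \<le> \<eta>" "mod_ent n Y \<le> \<eta>" using W \<delta>(1) \<eta>(1) by auto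
qed

text \<open>The choice of \<open>\<delta>\<close> depends on \<open>\<eta>\<close> alone. Uniformity
  in \<open>n\<close> is essential, because the modulus to which the gap is applied is not known in
  advance.\<close>

lemma mod_ent_gap:
  assumes "0 < \<eta>" "\<eta> \<le> 1"
  shows "\<exists>\<delta>>0. \<forall>n X Y. finite (set_pmf X) \<longrightarrow> finite (set_pmf Y) \<longrightarrow> mod_rdist n X Y \<le> \<delta> \<longrightarrow>
    (mod_ent n X \<le> \<eta> \<and> mod_ent n Y \<le> \<eta>) \<or> (ln 2 - \<eta> \<le> mod_ent n X \<and> ln 2 - \<eta> \<le> mod_ent n Y)"
proof -
  define \<theta> where "\<theta> = (\<eta> / 18)\<^sup>2"
  define \<delta> where "\<delta> = min (\<eta> / 18) ((\<eta> * \<theta>)\<^sup>2 / 8)"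
  have "\<eta>\<^sup>2 \<le> 1" using assms by (simp add: power_le_one)
  hence \<theta>: "0 < \<theta>" "\<theta> \<le> 1 / 8" using assms by (auto simp: \<theta>_def power_divide)
  have "sqrt (2 * \<theta>) \<le> sqrt (4 * \<theta>)" using \<theta> by (intro real_sqrt_le_mono) auto
  also have "\<dots> = \<eta> / 9" using assms by (simp add: \<theta>_def real_sqrt_mult)
  finally have \<theta>': "9 * sqrt (2 * \<theta>) \<le> \<eta>" by simp
  have \<delta>: "\<delta> > 0" "\<delta> \<le> \<eta> / 18" "8 * \<delta> \<le> (\<eta> * \<theta>)\<^sup>2"
    using assms \<theta> by (auto simp: \<delta>_def min_def)
  show ?thesis
  proof (intro exI[of _ \<delta>] conjI allI impI \<delta>(1))
    fix n X Y
    assume fin: "finite (set_pmf X)" "finite (set_pmf Y)" and d: "mod_rdist n X Y \<le> \<delta>"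
    note small = small_mod_ent[OF _ _ assms less_imp_le[OF \<theta>(1)] \<theta>(2) \<theta>' \<delta>(2,3)]
    have "mod_ent n X \<le> \<eta> \<and> mod_ent n Y \<le> \<eta>" if "mod_ent n X < ln 2 - \<eta> \<or> mod_ent n Y < ln 2 - \<eta>"
      using that small[OF fin d] small[OF fin(2,1)] d mod_rdist_commute[OF fin, of n] by auto
    thus "(mod_ent n X \<le> \<eta> \<and> mod_ent n Y \<le> \<eta>) \<or> (ln 2 - \<eta> \<le> mod_ent n X \<and> ln 2 - \<eta> \<le> mod_ent n Y)"
      by force
  qed
qed

section \<open>Integer random variables of large entropy\<close>

text \<open>A large power of two separates the finite support. Hence the residues of a variable of
  large entropy cannot stay almost constant at all scales.\<close>

lemma mod_ent_power_two_eq_entropy: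
  assumes "finite (set_pmf X)"
  shows "\<exists>k. mod_ent (2 ^ k) X = shannon_entropy X"
proof -
  define N where "N = (\<Sum>x\<in>set_pmf X. \<bar>x\<bar>)"
  have N: "\<bar>x\<bar> \<le> N" if "x \<in> set_pmf X" for x
    unfolding N_def using assms that by (intro member_le_sum) auto
  have N0: "0 \<le> N" by (simp add: N_def sum_nonneg)
  define k where "k = nat (2 * N)"
  have "2 * N = int k" using N0 by (simp add: k_def)
  also have "int k < int (2 ^ k)" by (simp only: of_nat_less_iff less_exp)
  finally have k: "2 * N < 2 ^ k" by simp
  have "ent X (\<lambda>x. x mod 2 ^ k) = ent X (\<lambda>x. x)"
  proof (rule ent_eq[OF assms])
    fix x y assume xy: "x \<in> set_pmf X" "y \<in> set_pmf X"
    have "x = y" if "2 ^ k dvd x - y"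
    proof (rule ccontr)
      assume "x \<noteq> y"
      hence "\<bar>2 ^ k\<bar> \<le> \<bar>x - y\<bar>" using that by (intro dvd_imp_le_int) auto
      thus False using N[OF xy(1)] N[OF xy(2)] k by simp
    qed
    thus "x mod 2 ^ k = y mod 2 ^ k \<longleftrightarrow> x = y" by (auto simp: mod_eq_dvd_iff)
  qed
  thus ?thesis by (auto simp: mod_ent_def ent_ident)
qed

text \<open>
  The constants \<open>c\<close> and \<open>\<delta>\<close> say that \<open>X\<close>, \<open>Y\<close> nearly minimise the distance among all pairs of
  large entropy. Such minimisers may be taken symmetric, and at the first scale \<open>2 ^ k\<close> where their
  residues are not almost constant, these residues carry almost one bit.
\<close>

lemma near_minimisers:
  fixes X Y :: "int pmf"
  assumes gap: "\<And>n X Y. finite (set_pmf X) \<Longrightarrow> finite (set_pmf Y) \<Longrightarrow> mod_rdist n X Y \<le> 6 * \<delta> \<Longrightarrow>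
      (mod_ent n X \<le> \<eta> \<and> mod_ent n Y \<le> \<eta>) \<or> (ln 2 - \<eta> \<le> mod_ent n X \<and> ln 2 - \<eta> \<le> mod_ent n Y)"
    and \<eta>: "0 \<le> \<eta>" "\<eta> \<le> 1" and \<delta>: "0 < \<delta>" "\<delta> \<le> 1"
    and c: "0 \<le> c" "0 \<le> c'" "c - \<delta> \<le> c'" "c' \<le> c"
    and low: "\<And>X Y :: int pmf. finite (set_pmf X) \<Longrightarrow> finite (set_pmf Y) \<Longrightarrow>
      h0 \<le> shannon_entropy X \<Longrightarrow> h0 \<le> shannon_entropy Y \<Longrightarrow> c' \<le> rdist X Y"
    and fin: "finite (set_pmf X)" "finite (set_pmf Y)"
    and h: "\<bar>h0\<bar> + 4 * (c + 1)\<^sup>2 / \<delta> + 2 * c + 10 \<le> shannon_entropy X"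
           "\<bar>h0\<bar> + 4 * (c + 1)\<^sup>2 / \<delta> + 2 * c + 10 \<le> shannon_entropy Y"
    and d: "rdist X Y \<le> c + \<delta>"
  shows "ln 2 - 2 * \<eta> - 8 * \<delta> \<le> 2 * c"
proof -
  define h1 where "h1 = \<bar>h0\<bar> + 4 * (c + 1)\<^sup>2 / \<delta>"
  have sq: "0 < (c + 1)\<^sup>2" using c by simp
  have pos: "0 < 4 * (c + 1)\<^sup>2 / \<delta>" using sq \<delta> by simp
  have h1: "0 \<le> h1" "h0 < h1" "4 * (c + 1)\<^sup>2 / \<delta> \<le> h1 - h0" using pos by (auto simp: h1_def)
  have hX: "h1 + 2 * c + 10 \<le> shannon_entropy X" "h1 + 2 * c + 10 \<le> shannon_entropy Y"
    using h by (auto simp: h1_def)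
  \<comment> \<open>One \<open>\<delta>\<close> is lost from \<open>c'\<close> to \<open>c\<close>,
    the other to the correction term, which \<open>h1\<close> is large enough to keep below
    \<open>\<delta>\<close>.\<close>
  have cr: "c - 2 * \<delta> \<le> crdist p f g q f' g'"
    if "finite (set_pmf p)" "finite (set_pmf q)"
      "h1 \<le> ent p (\<lambda>w. (f w, g w)) - ent p g" "h1 \<le> ent q (\<lambda>w. (f' w, g' w)) - ent q g'"
    for p :: "'v pmf" and q :: "'w pmf" and f f' :: "_ \<Rightarrow> int" and g :: "_ \<Rightarrow> int" and g' :: "_ \<Rightarrow> int"
  proof -
    have "c'\<^sup>2 \<le> (c + 1)\<^sup>2" using c by (intro power_mono) auto
    hence "4 * c'\<^sup>2 \<le> 4 * (c + 1)\<^sup>2" by simp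
    also have "\<dots> \<le> \<delta> * (h1 - h0)" using h1(3) \<delta> by (simp add: divide_le_eq mult.commute)
    finally have "4 * c'\<^sup>2 / (h1 - h0) \<le> \<delta>" using h1(2) by (simp add: divide_le_eq)
    moreover have "c' - 4 * c'\<^sup>2 / (h1 - h0) \<le> crdist p f g q f' g'"
      by (rule crdist_lower_bound[OF that(1,2) low c(2) h1(2) that(3,4)])
    ultimately show ?thesis using c by linarith
  qed
  define U where "U = diff_pmf X"
  define V where "V = diff_pmf Y"
  have finUV: "finite (set_pmf U)" "finite (set_pmf V)"
    using fin by (auto simp: U_def V_def finite_diff_pmf)
  have sym: "map_pmf uminus U = U" "map_pmf uminus V = V"
    by (auto simp: U_def V_def diff_pmf_symmetric)
  have HU: "shannon_entropy X \<le> shannon_entropy U" "shannon_entropy Y \<le> shannon_entropy V"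
    using fin by (auto simp: U_def V_def entropy_diff_pmf_ge)
  have "shannon_entropy U \<le> shannon_entropy X + 2 * rdist X Y"
    "shannon_entropy V \<le> shannon_entropy Y + 2 * rdist X Y"
    using entropy_diff_pmf_le[OF fin] entropy_diff_pmf_le[OF fin(2,1)] rdist_commute[OF fin]
    by (auto simp: U_def V_def)
  \<comment> \<open>Given \<open>x1 - x2\<close>, the entropy left in \<open>x1\<close> is
    \<open>2 * shannon_entropy X - shannon_entropy U\<close>, at least
    \<open>shannon_entropy X - 2 * rdist X Y\<close>; the same holds for \<open>Y\<close>. The
    margin \<open>2 * c + 10\<close> keeps both above \<open>h1\<close>.\<close>
  hence "c - 2 * \<delta> \<le> crdist (pair_pmf X X) fst (\<lambda>w. fst w - snd w) (pair_pmf Y Y) fst (\<lambda>w. fst w - snd w)"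
    using hX d \<delta> fin
    by (intro cr) (auto simp: ent_fst_diff U_def V_def entropy_diff_pmf)
  hence rUV: "rdist U V \<le> c + 4 * \<delta>"
    using rdist_diff_pmf_le[OF fin] d by (simp add: U_def V_def)
  define small where "small = (\<lambda>k::nat. mod_ent (2 ^ k) U \<le> \<eta> \<and> mod_ent (2 ^ k) V \<le> \<eta>)"
  \<comment> \<open>Modulo \<open>1\<close> every residue is constant, so the search for the first
    scale that is not small starts from a small one.\<close>
  have "small 0" using \<eta> by (simp add: small_def mod_ent_def ent_const)
  moreover have "\<exists>k. \<not> small k"
  proof -
    obtain k where "mod_ent (2 ^ k) U = shannon_entropy U"
      using mod_ent_power_two_eq_entropy[OF finUV(1)] by auto
    thus ?thesis using hX(1) HU(1) h1(1) c(1) \<eta> by (intro exI[of _ k]) (auto simp: small_def)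
  qed
  ultimately obtain k where k: "small k" "\<not> small (Suc k)"
    by (metis nat_induct)
  have U: "mod_ent (2 ^ Suc k) U \<le> 2 * c + 8 * \<delta> + \<eta>"
    using two_rdist_ge_parity[OF finUV sym(2), of "2 ^ k"] rUV k(1) by (simp add: small_def)
  have V: "mod_ent (2 ^ Suc k) V \<le> 2 * c + 8 * \<delta> + \<eta>"
    using two_rdist_ge_parity[OF finUV(2,1) sym(1), of "2 ^ k"] rUV k(1) rdist_commute[OF finUV]
    by (simp add: small_def)
  \<comment> \<open>The residues at the critical scale have entropy at most
    \<open>2 * c + 9\<close>, so conditioning on them still leaves at least \<open>h1\<close>.
    Fibring then leaves at most \<open>(c + 4 * \<delta>) - (c - 2 * \<delta>)\<close> for the
    distance of the residues.\<close>
  have "c - 2 * \<delta> \<le> crdist U (\<lambda>x. x) (\<lambda>x. x mod 2 ^ Suc k) V (\<lambda>x. x) (\<lambda>x. x mod 2 ^ Suc k)"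
  proof (rule cr[OF finUV])
    show "h1 \<le> ent U (\<lambda>w. (w, w mod 2 ^ Suc k)) - ent U (\<lambda>x. x mod 2 ^ Suc k)"
      using ent_graph[OF finUV(1), of "\<lambda>x. x" "\<lambda>x. x mod 2 ^ Suc k"] U HU hX \<delta> \<eta>
      by (simp add: ent_ident mod_ent_def)
    show "h1 \<le> ent V (\<lambda>w. (w, w mod 2 ^ Suc k)) - ent V (\<lambda>x. x mod 2 ^ Suc k)"
      using ent_graph[OF finUV(2), of "\<lambda>x. x" "\<lambda>x. x mod 2 ^ Suc k"] V HU hX \<delta> \<eta>
      by (simp add: ent_ident mod_ent_def)
  qed
  hence "mod_rdist (2 ^ Suc k) U V \<le> 6 * \<delta>"
    using rdist_ge_mod[OF finUV, of "2 ^ Suc k"] rUV by linarith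
  from gap[OF finUV this] have "ln 2 - \<eta> \<le> mod_ent (2 ^ Suc k) U"
    using k(2) by (auto simp: small_def)
  thus ?thesis using U by linarith
qed

text \<open>The reflected pair is the case of interest, but the argument ranges over all pairs:
  \<open>c\<close> is the supremum of the lower bounds valid for pairs of large entropy.\<close>

theorem rdist_reflect_ge:
  assumes "0 < \<epsilon>"
  shows "\<exists>C. \<forall>X :: int pmf. finite (set_pmf X) \<longrightarrow> C \<le> shannon_entropy X \<longrightarrow>
    ln 2 / 2 - \<epsilon> \<le> rdist X (map_pmf uminus X)"
proof (rule ccontr)
  assume "\<not> ?thesis"
  hence bad: "\<exists>X :: int pmf. finite (set_pmf X) \<and> C \<le> shannon_entropy X \<and> rdist X (map_pmf uminus X) < ln 2 / 2 - \<epsilon>" for C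
    by (force simp: not_le)
  define low where "low = (\<lambda>c h. \<forall>X Y :: int pmf. finite (set_pmf X) \<longrightarrow> finite (set_pmf Y) \<longrightarrow>
    h \<le> shannon_entropy X \<longrightarrow> h \<le> shannon_entropy Y \<longrightarrow> c \<le> rdist X Y)"
  define S where "S = {c. 0 \<le> c \<and> (\<exists>h. low c h)}"
  have nonneg: "0 \<le> rdist X Y" if "finite (set_pmf X)" "finite (set_pmf Y)" for X Y :: "int pmf"
    by (rule order_trans[OF _ rdist_ge[OF that]]) simp
  have S0: "0 \<in> S" using nonneg by (auto simp: S_def low_def)
  \<comment> \<open>The assumed counterexamples exist at every entropy level and so bound
    \<open>S\<close> from above.\<close>
  have Sb: "c \<le> ln 2 / 2 - \<epsilon>" if c: "c \<in> S" for c
  proof -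
    obtain h where h: "low c h" using c by (auto simp: S_def)
    obtain X :: "int pmf" where X: "finite (set_pmf X)" "h \<le> shannon_entropy X"
      "rdist X (map_pmf uminus X) < ln 2 / 2 - \<epsilon>"
      using bad by blast
    have "shannon_entropy (map_pmf uminus X) = ent X (\<lambda>x. x)"
      unfolding ent_def[symmetric] by (rule ent_eq[OF X(1)]) auto
    thus ?thesis using h X unfolding low_def
      by (metis ent_ident finite_imageI set_map_pmf less_imp_le order_trans)
  qed
  define c where "c = Sup S"
  have bdd: "bdd_above S" using Sb by (intro bdd_aboveI) auto
  have c: "0 \<le> c" "c \<le> ln 2 / 2 - \<epsilon>"
    unfolding c_def using S0 Sb bdd by (auto intro: cSup_upper cSup_least)
  \<comment> \<open>The sizes of \<open>\<eta>\<close> and \<open>\<delta>\<close> keep the loss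
    \<open>2 * \<eta> + 8 * \<delta>\<close> below \<open>2 * \<epsilon>\<close>, the distance that
    \<open>2 * c\<close> is assumed to keep from \<open>ln 2\<close>.\<close>
  define \<eta> where "\<eta> = min 1 (\<epsilon> / 4)"
  have \<eta>: "0 < \<eta>" "\<eta> \<le> 1" "4 * \<eta> \<le> \<epsilon>" using assms by (auto simp: \<eta>_def)
  obtain \<delta>0 where \<delta>0: "\<delta>0 > 0" and gap: "\<And>n X Y. finite (set_pmf X) \<Longrightarrow> finite (set_pmf Y) \<Longrightarrow> mod_rdist n X Y \<le> \<delta>0 \<Longrightarrow>
      (mod_ent n X \<le> \<eta> \<and> mod_ent n Y \<le> \<eta>) \<or> (ln 2 - \<eta> \<le> mod_ent n X \<and> ln 2 - \<eta> \<le> mod_ent n Y)"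
    using mod_ent_gap[OF \<eta>(1,2)] by blast
  define \<delta> where "\<delta> = min (min 1 (\<epsilon> / 8)) (\<delta>0 / 6)"
  have \<delta>: "0 < \<delta>" "\<delta> \<le> 1" "8 * \<delta> \<le> \<epsilon>" "6 * \<delta> \<le> \<delta>0" using assms \<delta>0 by (auto simp: \<delta>_def min_def)
  obtain c' where c': "c' \<in> S" "c - \<delta> < c'"
    using less_cSupD[of S "c - \<delta>"] S0 \<delta>(1) by (auto simp: c_def)
  then obtain h0 where h0: "low c' h0" by (auto simp: S_def)
  have c'': "0 \<le> c'" "c' \<le> c" using c'(1) bdd by (auto simp: S_def c_def intro: cSup_upper)
  \<comment> \<open>As \<open>c\<close> is the supremum, \<open>c + \<delta>\<close> fails at every
    entropy level, in particular at the one required by \<open>near_minimisers\<close>.\<close>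
  have "c + \<delta> \<notin> S" using cSup_upper[OF _ bdd, of "c + \<delta>"] \<delta>(1) by (auto simp: c_def)
  hence "\<not> low (c + \<delta>) (\<bar>h0\<bar> + 4 * (c + 1)\<^sup>2 / \<delta> + 2 * c + 10)"
    using c(1) \<delta>(1) by (auto simp: S_def)
  then obtain X Y :: "int pmf" where XY: "finite (set_pmf X)" "finite (set_pmf Y)"
    "\<bar>h0\<bar> + 4 * (c + 1)\<^sup>2 / \<delta> + 2 * c + 10 \<le> shannon_entropy X"
    "\<bar>h0\<bar> + 4 * (c + 1)\<^sup>2 / \<delta> + 2 * c + 10 \<le> shannon_entropy Y" "rdist X Y < c + \<delta>"
    by (auto simp: low_def not_le)
  have "ln 2 - 2 * \<eta> - 8 * \<delta> \<le> 2 * c"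
  proof (rule near_minimisers[OF _ _ \<eta>(2) \<delta>(1,2) c(1) c''(1) _ c''(2) _ XY(1-4)])
    show "(mod_ent n X \<le> \<eta> \<and> mod_ent n Y \<le> \<eta>) \<or> (ln 2 - \<eta> \<le> mod_ent n X \<and> ln 2 - \<eta> \<le> mod_ent n Y)"
      if "finite (set_pmf X)" "finite (set_pmf Y)" "mod_rdist n X Y \<le> 6 * \<delta>" for n X Y
      using gap[of X Y n] that \<delta>(4) by linarith
    show "c' \<le> rdist X Y" if "finite (set_pmf X)" "finite (set_pmf Y)"
      "h0 \<le> shannon_entropy X" "h0 \<le> shannon_entropy Y" for X Y :: "int pmf"
      using h0 that by (auto simp: low_def)
  qed (use \<eta> c' XY in auto)
  thus False using c(2) \<eta> \<delta> assms by (simp add: field_simps)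
qed

section \<open>Integer models of random variables in torsion-free groups\<close>

text \<open>A homomorphism that vanishes on no nonzero difference of two elements of
  \<open>P\<close> is injective on the sums, hence a Freiman isomorphism onto its image. Entropies
  depend only on which values coincide.\<close>

lemma integer_model:
  fixes G (structure)
  assumes G: "comm_group G" and tf: "torsion_free G" and X: "group_random_variable G X"
  shows "\<exists>Y :: int pmf. finite (set_pmf Y) \<and> shannon_entropy Y = shannon_entropy X \<and>
    ent (pair_pmf Y Y) (\<lambda>w. fst w + snd w) = shannon_entropy (indep_sum G X)"
proof -
  interpret comm_group G by (rule G)
  let ?S = "set_pmf X"
  have S: "finite ?S" "?S \<subseteq> carrier G" using X by (auto simp: group_random_variable_def)
  obtain H where H: "?S \<subseteq> H" "int_separated G H" using int_separated_exists[OF G tf S] by auto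
  have sub: "subgroup H G" using H(2) by (simp add: int_separated_def)
  note Hc = subgroup.mem_carrier[OF sub]
  define P where "P = (\<lambda>(x, y). x \<otimes> y) ` (?S \<times> ?S)"
  define F where "F = (\<lambda>(a, b). a \<otimes> inv b) ` (P \<times> P) - {\<one>}"
  have P: "finite P" "P \<subseteq> H"
    using S(1) H(1) subgroup.m_closed[OF sub] by (auto simp: P_def)
  have "finite F" "F \<subseteq> H - {\<one>}"
    using P(1) subsetD[OF P(2)]
    by (auto simp: F_def intro!: subgroup.m_closed[OF sub] subgroup.m_inv_closed[OF sub])
  then obtain \<phi> :: "'a \<Rightarrow> int" where add: "\<And>x y. x \<in> H \<Longrightarrow> y \<in> H \<Longrightarrow> \<phi> (x \<otimes> y) = \<phi> x + \<phi> y"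
    and nz: "\<And>x. x \<in> F \<Longrightarrow> \<phi> x \<noteq> 0"
    by (rule int_separatedE[OF H(2)]) (rule that)
  have injP: "a = b" if ab: "a \<in> P" "b \<in> P" "\<phi> a = \<phi> b" for a b
  proof (rule ccontr)
    assume ne: "a \<noteq> b"
    have c: "a \<in> carrier G" "b \<in> carrier G" "b \<in> H" using ab P(2) Hc by auto
    have d: "a \<otimes> inv b \<otimes> b = a" using c by (simp add: m_assoc)
    hence "a \<otimes> inv b \<noteq> \<one>" using ne c by auto
    hence "a \<otimes> inv b \<in> F" using ab by (auto simp: F_def)
    moreover have "\<phi> (a \<otimes> inv b \<otimes> b) = \<phi> (a \<otimes> inv b) + \<phi> b"
      using ab P(2) c by (intro add subgroup.m_closed[OF sub] subgroup.m_inv_closed[OF sub]) auto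
    ultimately show False using nz ab(3) d by simp
  qed
  have injS: "x = y" if xy: "x \<in> ?S" "y \<in> ?S" "\<phi> x = \<phi> y" for x y
  proof -
    \<comment> \<open>Injectivity on the support follows from that on the sums by adding a common
      element.\<close>
    have "\<phi> (x \<otimes> x) = \<phi> (y \<otimes> x)" using xy H(1) by (simp add: add subset_iff)
    moreover have "x \<otimes> x \<in> P" "y \<otimes> x \<in> P" using xy by (auto simp: P_def)
    ultimately have "x \<otimes> x = y \<otimes> x" by (intro injP)
    thus ?thesis using xy S(2) by (auto simp: subset_iff)
  qed
  have finXX: "finite (set_pmf (pair_pmf X X))" using S(1) by simp
  define Y where "Y = map_pmf \<phi> X"
  have HY: "shannon_entropy Y = ent X (\<lambda>x. x)"
    unfolding Y_def ent_def[symmetric] by (rule ent_eq[OF S(1)]) (auto dest: injS)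
  have "pair_pmf Y Y = map_pmf (\<lambda>w. (\<phi> (fst w), \<phi> (snd w))) (pair_pmf X X)"
    using map_pair[of \<phi> \<phi> X X] by (simp add: Y_def case_prod_beta')
  hence "ent (pair_pmf Y Y) (\<lambda>w. fst w + snd w) = ent (pair_pmf X X) (\<lambda>w. \<phi> (fst w) + \<phi> (snd w))"
    by (simp add: ent_map)
  also have "\<dots> = ent (pair_pmf X X) (\<lambda>w. \<phi> (fst w \<otimes> snd w))"
    using H(1) by (intro ent_cong) (auto simp: add subset_iff)
  also have "\<dots> = ent (pair_pmf X X) (\<lambda>w. fst w \<otimes> snd w)"
  proof (rule ent_eq[OF finXX])
    fix w w' assume "w \<in> set_pmf (pair_pmf X X)" "w' \<in> set_pmf (pair_pmf X X)"
    hence "fst w \<otimes> snd w \<in> P" "fst w' \<otimes> snd w' \<in> P" by (auto simp: P_def)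
    thus "\<phi> (fst w \<otimes> snd w) = \<phi> (fst w' \<otimes> snd w') \<longleftrightarrow> fst w \<otimes> snd w = fst w' \<otimes> snd w'"
      using injP by auto
  qed
  also have "\<dots> = shannon_entropy (indep_sum G X)"
    by (simp add: ent_def indep_sum_def case_prod_beta')
  finally show ?thesis
    using S(1) HY by (intro exI[of _ Y]) (auto simp: ent_ident Y_def)
qed

text \<open>The integer model, re-encoded on \<open>nat\<close>, has the same entropy and doubling
  constant, so the same \<open>C\<close> carries over.\<close>

lemma entropy_threshold_transfer:
  assumes C: "entropy_threshold TYPE(nat) \<epsilon> C"
  shows "entropy_threshold TYPE('a) \<epsilon> C"
  unfolding entropy_threshold_def
proof (intro allI impI)
  fix G :: "'a monoid" and X :: "'a pmf"
  assume G: "comm_group G" "torsion_free G" and X: "group_random_variable G X" "C \<le> shannon_entropy X"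
  obtain Y :: "int pmf" where Y: "finite (set_pmf Y)" "shannon_entropy Y = shannon_entropy X"
    "ent (pair_pmf Y Y) (\<lambda>w. fst w + snd w) = shannon_entropy (indep_sum G X)"
    using integer_model[OF G X(1)] by auto
  define Z where "Z = map_pmf int_encode Y"
  have Z: "group_random_variable nat_group Z"
    using Y(1) by (simp add: group_random_variable_def Z_def carrier_nat_group)
  have HZ: "shannon_entropy Z = shannon_entropy X"
  proof -
    have "shannon_entropy Z = ent Y (\<lambda>x. x)"
      unfolding Z_def ent_def[symmetric] by (rule ent_eq[OF Y(1)]) (simp add: int_encode_eq)
    thus ?thesis using Y(2) by (simp add: ent_ident)
  qed
  have "shannon_entropy (indep_sum nat_group Z) = ent (pair_pmf Z Z) (\<lambda>w. fst w \<otimes>\<^bsub>nat_group\<^esub> snd w)"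
    by (simp add: ent_def indep_sum_def case_prod_beta')
  also have "pair_pmf Z Z = map_pmf (\<lambda>w. (int_encode (fst w), int_encode (snd w))) (pair_pmf Y Y)"
    using map_pair[of int_encode int_encode Y Y] by (simp add: Z_def case_prod_beta')
  also have "ent \<dots> (\<lambda>w. fst w \<otimes>\<^bsub>nat_group\<^esub> snd w) = ent (pair_pmf Y Y) (\<lambda>w. int_encode (fst w + snd w))"
    by (simp add: ent_map mult_nat_group)
  also have "\<dots> = ent (pair_pmf Y Y) (\<lambda>w. fst w + snd w)"
    using Y(1) by (intro ent_eq) (auto simp: int_encode_eq)
  finally have "doubling_constant nat_group Z = doubling_constant G X"
    using HZ Y(3) by (simp add: doubling_constant_def)
  moreover have "sqrt 2 - \<epsilon> \<le> doubling_constant nat_group Z"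
    using C comm_group_nat_group torsion_free_nat_group Z HZ X(2)
    by (simp add: entropy_threshold_def)
  ultimately show "sqrt 2 - \<epsilon> \<le> doubling_constant G X" by simp
qed

text \<open>For the integer model \<open>Y\<close>, the distance to its reflection is the logarithm
  of the doubling constant, which translates the bound \<open>ln 2 / 2\<close> into
  \<open>sqrt 2\<close>.\<close>

lemma entropy_threshold_exists:
  assumes "0 < \<epsilon>"
  shows "\<exists>C. entropy_threshold TYPE('a) \<epsilon> C"
proof -
  obtain C where C: "\<And>X :: int pmf. finite (set_pmf X) \<Longrightarrow> C \<le> shannon_entropy X \<Longrightarrow>
      ln 2 / 2 - \<epsilon> / 2 \<le> rdist X (map_pmf uminus X)"
    using rdist_reflect_ge[of "\<epsilon> / 2"] assms by auto
  have "entropy_threshold TYPE('a) \<epsilon> C"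
    unfolding entropy_threshold_def
  proof (intro allI impI)
    fix G :: "'a monoid" and X :: "'a pmf"
    assume G: "comm_group G" "torsion_free G" and X: "group_random_variable G X" "C \<le> shannon_entropy X"
    obtain Y :: "int pmf" where Y: "finite (set_pmf Y)" "shannon_entropy Y = shannon_entropy X"
      "ent (pair_pmf Y Y) (\<lambda>w. fst w + snd w) = shannon_entropy (indep_sum G X)"
      using integer_model[OF G X(1)] by auto
    have "shannon_entropy (map_pmf uminus Y) = ent Y (\<lambda>x. x)"
      unfolding ent_def[symmetric] by (rule ent_eq[OF Y(1)]) auto
    hence "shannon_entropy (map_pmf uminus Y) = shannon_entropy X" using Y(2) by (simp add: ent_ident)
    moreover have "pair_pmf Y (map_pmf uminus Y) = map_pmf (\<lambda>w. (fst w, - snd w)) (pair_pmf Y Y)"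
      using map_pair[of "\<lambda>x. x" uminus Y Y] by (simp add: case_prod_beta')
    ultimately have "rdist Y (map_pmf uminus Y) = shannon_entropy (indep_sum G X) - shannon_entropy X"
      using Y by (simp add: rdist_def ent_map)
    hence "ln (sqrt 2) - \<epsilon> / 2 \<le> shannon_entropy (indep_sum G X) - shannon_entropy X"
      using C[OF Y(1)] Y(2) X(2) by (simp add: ln_sqrt)
    hence "exp (ln (sqrt 2) - \<epsilon> / 2) \<le> doubling_constant G X"
      by (simp add: doubling_constant_def)
    \<comment> \<open>Halving \<open>\<epsilon>\<close> beforehand pays for exponentiation: the loss
      becomes \<open>sqrt 2 * \<epsilon> / 2\<close>, which is at most
      \<open>\<epsilon>\<close>.\<close>
    moreover have "sqrt 2 * (1 - \<epsilon> / 2) \<le> sqrt 2 * exp (- (\<epsilon> / 2))"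
      using exp_ge_add_one_self[of "- (\<epsilon> / 2)"] by (intro mult_left_mono) auto
    moreover have "sqrt 2 * exp (- (\<epsilon> / 2)) = exp (ln (sqrt 2) - \<epsilon> / 2)"
      by (subst diff_conv_add_uminus, subst exp_add) simp
    moreover have "sqrt 2 - \<epsilon> \<le> sqrt 2 * (1 - \<epsilon> / 2)"
    proof -
      have "sqrt 2 * \<epsilon> \<le> 2 * \<epsilon>" using assms by (intro mult_right_mono real_le_lsqrt) auto
      thus ?thesis by (simp add: algebra_simps)
    qed
    ultimately show "sqrt 2 - \<epsilon> \<le> doubling_constant G X" by linarith
  qed
  thus ?thesis by blast
qed

theorem theorem1p9:
  fixes \<epsilon> :: real
  assumes "\<epsilon> > 0"
  shows "(\<exists>C. entropy_threshold TYPE(nat) \<epsilon> C) \<and>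
         (\<forall>C. entropy_threshold TYPE(nat) \<epsilon> C \<longrightarrow> entropy_threshold TYPE('a) \<epsilon> C)"
  using entropy_threshold_exists[OF assms] entropy_threshold_transfer by blast

end
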